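(* Let $\{\alpha^t\}_{t\ge 0}$ be generated by the block-approximation descent method described in the context, started at a feasible $\alpha^0\in\Omega$, with line-search parameters $\beta,\tau\in(0,1)$ and with either line search variant. Suppose that: (i) $f$ satisfies the quadratic growth condition with some $\mu>0$: with $A$ the solution set of the dual problem, $$f(\alpha)-f^*\ge\frac{\mu}{2}\min_{\alpha^*\in A}\|\alpha-\alpha^*\|^2\quad\text{for all }\alpha;$$ (ii) there is $C_3>0$ with $\|B_t\|\le C_3$ for all $t$; (iii) there are constants $C_1\in[0,C_3]$, $C_2>0$ and $\gamma\in[0,1)$ with $(1+\sqrt\gamma)C_1+(1-\sqrt\gamma)C_2>0$ such that, for all $t$, the smallest eigenvalue of $B_t$ is at least $C_1$, $Q^{\alpha^t}_{B_t}$ is $C_2$-strongly convex, and $\Delta\alpha^t$ solves the sub-problem $\gamma$-approximately. Put $$m:=\min\left\{1-\gamma,\ \frac{\beta(1-\tau)\sigma\left((1-\gamma)C_1+(1-\sqrt\gamma)^2C_2\right)}{\|X^TX\|}\right\}.$$ Then the dual objective values converge Q-linearly to $f^*$: for all $t\ge0$, $$f(\alpha^{t+1})-f^*\le\begin{cases}\left(1-\dfrac{\tau\mu}{4C_3}\,m\right)\bigl(f(\alpha^t)-f^*\bigr)&\text{if }\mu\le 2C_3,\\[2mm]\left(1-\tau\left(1-\dfrac{C_3}{\mu}\right)m\right)\bigl(f(\alpha^t)-f^*\bigr)&\text{otherwise.}\end{cases}$$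
   Context: Problem. Let $l,n\ge1$, $c_i\ge 1$, $X_i\in\mathbb{R}^{n\times c_i}$ for $i=1,\dots,l$, $N=\sum_i c_i$, $X=[X_1,\dots,X_l]\in\mathbb{R}^{n\times N}$. The primal problem is $\min_{w\in\mathbb{R}^n} f^P(w):=g(w)+\sum_{i=1}^l\xi_i(X_i^Tw)$, where $g$ (possibly extended-valued) is $\sigma$-strongly convex for some $\sigma>0$, each $\xi_i$ is convex, $f^P$ is proper, closed and convex, and the primal solution set is nonempty. Write $\xi(z)=\sum_{i}\xi_i(z_i)$ for $z=(z_1,\dots,z_l)\in\mathbb{R}^N$, $z_i\in\mathbb{R}^{c_i}$. For a function $h$, $h^*(u)=\sup_{z\in\mathrm{dom}(h)} z^Tu-h(z)$ is its convex conjugate, so $\xi^*(-\alpha)=\sum_i\xi_i^*(-\alpha_i)$. The dual problem is $\min_{\alpha\in\Omega} f(\alpha):=G^*(\alpha)+\xi^*(-\alpha)$, where $G^*(\alpha):=g^*(X\alpha)$ and $\Omega=\prod_{i=1}^l -\mathrm{dom}(\xi_i^* )\subseteq\mathbb{R}^N$; $f^*$ is its optimal value. ($g^*$ is finite and differentiable with $(1/\sigma)$-Lipschitz gradient.) Standing assumption: either $\xi$ is differentiable with $\rho$-Lipschitz continuous gradient for some $\rho>0$, or $\xi$ is $L$-Lipschitz continuous for some $L>0$. Method. At iteration $t$, given $\alpha^t\in\Omega$ and a symmetric matrix $B_t\in\mathbb{R}^{N\times N}$, let $$Q^{\alpha^t}_{B_t}(d):=\nabla G^*(\alpha^t)^Td+\tfrac12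 d^TB_td+\xi^*(-\alpha^t-d).$$ A direction $\Delta\alpha^t$ is obtained by (exactly or approximately) minimizing $Q^{\alpha^t}_{B_t}$, and $\alpha^{t+1}=\alpha^t+\eta_t\Delta\alpha^t$. We say $\Delta\alpha^t$ solves the sub-problem $\gamma$-approximately if $$Q^{\alpha^t}_{B_t}(\Delta\alpha^t)-\min_dQ^{\alpha^t}_{B_t}(d)\le\gamma\left(Q^{\alpha^t}_{B_t}(0)-\min_dQ^{\alpha^t}_{B_t}(d)\right).$$ The step size $\eta_t$ is chosen by one of two variants: Variant I (backtracking): $\eta_t=\beta^i$ for the smallest integer $i\ge0$ such that $\eta=\beta^i$ satisfies $f(\alpha^t+\eta\Delta\alpha^t)\le f(\alpha^t)+\eta\tau\Delta_t$, where $\Delta_t:=\nabla G^*(\alpha^t)^T\Delta\alpha^t+\xi^*(-\alpha^t-\Delta\alpha^t)-\xi^*(-\alpha^t)$. Variant II (exact line search): $\eta_t\in\arg\min_{\eta\in\mathbb{R}} f(\alpha^t+\eta\Delta\alpha^t)$. $\|\cdot\|$ is the Euclidean norm for vectors and the spectral norm for matrices. A quotient with denominator $\|X^TX\|$ is read as $+\infty$ if $X=0$. *)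

theory Defs
  imports "HOL-Analysis.Analysis"
begin

text \<open>
  Extended-valued functions take values in \<^typ>\<open>ereal\<close>. In the arithmetic of \<^typ>\<open>ereal\<close>,
  \<open>\<infinity> + (-\<infinity>) = \<infinity>\<close>.
\<close>

definition edom :: "('a \<Rightarrow> ereal) \<Rightarrow> 'a set" where
  "edom h = {x. h x < \<infinity>}"

definition proper_fun :: "('a \<Rightarrow> ereal) \<Rightarrow> bool" where
  "proper_fun h \<longleftrightarrow> edom h \<noteq> {} \<and> (\<forall>x. h x \<noteq> -\<infinity>)"

text \<open>A function is closed (convex) iff this set is closed (convex).\<close>

definition ereal_epigraph :: "('a \<Rightarrow> ereal) \<Rightarrow> ('a \<times> real) set" where
  "ereal_epigraph h = {(x, r). h x \<le> ereal r}"

definition strongly_convex :: "real \<Rightarrow> ('a::real_inner \<Rightarrow> ereal) \<Rightarrow> bool" where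
  "strongly_convex s h \<longleftrightarrow>
     (\<forall>x y. \<forall>u\<in>{0<..<1::real}.
        h ((1 - u) *\<^sub>R x + u *\<^sub>R y) + ereal (s / 2 * (1 - u) * u * (norm (x - y))\<^sup>2)
          \<le> ereal (1 - u) * h x + ereal u * h y)"

text \<open>The convex conjugate of a function whose ambient space is the linear subspace \<open>S\<close>.\<close>

definition conjugate_on :: "'a::real_inner set \<Rightarrow> ('a \<Rightarrow> ereal) \<Rightarrow> 'a \<Rightarrow> ereal" where
  "conjugate_on S h u = (SUP z \<in> S \<inter> edom h. ereal (z \<bullet> u) - h z)"

abbreviation conjugate :: "('a::real_inner \<Rightarrow> ereal) \<Rightarrow> 'a \<Rightarrow> ereal" where
  "conjugate \<equiv> conjugate_on UNIV"

definition gradient :: "('a::real_inner \<Rightarrow> real) \<Rightarrow> 'a \<Rightarrow> 'a" where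
  "gradient h x = (THE D. GDERIV h x :> D)"

definition eigenvalue :: "real^'a^'a \<Rightarrow> real \<Rightarrow> bool" where
  "eigenvalue M k \<longleftrightarrow> (\<exists>v. v \<noteq> 0 \<and> M *v v = k *\<^sub>R v)"

text \<open>The operator norm induced by the Euclidean norms.\<close>

definition spectral_norm :: "real^'a^'b \<Rightarrow> real" where
  "spectral_norm M = onorm (\<lambda>v. M *v v)"

text \<open>
  The \<open>N\<close> coordinates are indexed by \<^typ>\<open>'m\<close>, and \<open>blk j\<close> is the block containing coordinate \<open>j\<close>;
  when \<open>blk\<close> is surjective, all block sizes \<open>c\<^sub>i\<close> are at least \<open>1\<close>. The space of the \<open>i\<close>-th block
  is represented, isometrically, by the vectors supported on the coordinates of that block. So \<open>z\<^sub>i\<close>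
  is \<open>block_part blk i z\<close>, and for \<open>X = [X\<^sub>1, \<dots>, X\<^sub>l]\<close> (columns indexed by \<^typ>\<open>'m\<close>) the vector
  \<open>X\<^sub>i\<^sup>T w\<close> is \<open>block_part blk i (transpose X *v w)\<close>. Values of the \<open>i\<close>-th loss \<open>\<xi> i\<close> outside
  \<open>block_space blk i\<close> are never used.
\<close>

definition block_space :: "('m \<Rightarrow> 'l) \<Rightarrow> 'l \<Rightarrow> (real^'m) set" where
  "block_space blk i = {z. \<forall>j. blk j \<noteq> i \<longrightarrow> z $ j = 0}"

definition block_part :: "('m \<Rightarrow> 'l) \<Rightarrow> 'l \<Rightarrow> real^'m \<Rightarrow> real^'m" where
  "block_part blk i z = (\<chi> j. if blk j = i then z $ j else 0)"

definition block_sum :: "('m \<Rightarrow> 'l::finite) \<Rightarrow> ('l \<Rightarrow> real^'m \<Rightarrow> real) \<Rightarrow> real^'m \<Rightarrow> real" where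
  "block_sum blk \<xi> z = (\<Sum>i\<in>UNIV. \<xi> i (block_part blk i z))"

definition primal ::
  "(real^'n \<Rightarrow> ereal) \<Rightarrow> ('m \<Rightarrow> 'l::finite) \<Rightarrow> ('l \<Rightarrow> real^'m \<Rightarrow> real) \<Rightarrow> real^'m^'n
    \<Rightarrow> real^'n \<Rightarrow> ereal" where
  "primal g blk \<xi> X w =
     g w + ereal (\<Sum>i\<in>UNIV. \<xi> i (block_part blk i (transpose X *v w)))"

definition xi_conj ::
  "('m::finite \<Rightarrow> 'l::finite) \<Rightarrow> ('l \<Rightarrow> real^'m \<Rightarrow> real) \<Rightarrow> real^'m \<Rightarrow> ereal" where
  "xi_conj blk \<xi> = conjugate (\<lambda>z. ereal (block_sum blk \<xi> z))"

definition G_conj :: "(real^'n \<Rightarrow> ereal) \<Rightarrow> real^'m^'n \<Rightarrow> real^'m \<Rightarrow> ereal" where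
  "G_conj g X a = conjugate g (X *v a)"

text \<open>
  When \<open>g\<close> is proper and strongly convex, \<open>g\<^sup>*\<close> is finite everywhere, so that
  \<^const>\<open>real_of_ereal\<close> only changes the type.
\<close>

definition grad_G_conj :: "(real^'n \<Rightarrow> ereal) \<Rightarrow> real^'m^'n \<Rightarrow> real^'m \<Rightarrow> real^'m" where
  "grad_G_conj g X = gradient (\<lambda>a. real_of_ereal (G_conj g X a))"

definition dual ::
  "(real^'n \<Rightarrow> ereal) \<Rightarrow> ('m \<Rightarrow> 'l::finite) \<Rightarrow> ('l \<Rightarrow> real^'m \<Rightarrow> real) \<Rightarrow> real^'m^'n
    \<Rightarrow> real^'m \<Rightarrow> ereal" where
  "dual g blk \<xi> X a = G_conj g X a + xi_conj blk \<xi> (- a)"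

definition dual_feasible ::
  "('m::finite \<Rightarrow> 'l) \<Rightarrow> ('l \<Rightarrow> real^'m \<Rightarrow> real) \<Rightarrow> (real^'m) set" where
  "dual_feasible blk \<xi> =
     {a. \<forall>i. - block_part blk i a \<in> edom (conjugate_on (block_space blk i) (\<lambda>z. ereal (\<xi> i z)))}"

definition dual_opt ::
  "(real^'n \<Rightarrow> ereal) \<Rightarrow> ('m \<Rightarrow> 'l::finite) \<Rightarrow> ('l \<Rightarrow> real^'m \<Rightarrow> real) \<Rightarrow> real^'m^'n
    \<Rightarrow> ereal" where
  "dual_opt g blk \<xi> X = (INF a \<in> dual_feasible blk \<xi>. dual g blk \<xi> X a)"

definition dual_solutions ::
  "(real^'n \<Rightarrow> ereal) \<Rightarrow> ('m \<Rightarrow> 'l::finite) \<Rightarrow> ('l \<Rightarrow> real^'m \<Rightarrow> real) \<Rightarrow> real^'m^'n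
    \<Rightarrow> (real^'m) set" where
  "dual_solutions g blk \<xi> X = {a \<in> dual_feasible blk \<xi>. dual g blk \<xi> X a = dual_opt g blk \<xi> X}"

text \<open>
  The infimum is taken in \<^typ>\<open>ereal\<close>, so it is \<open>\<infinity>\<close> if there is no dual solution.
\<close>

definition quadratic_growth ::
  "(real^'n \<Rightarrow> ereal) \<Rightarrow> ('m \<Rightarrow> 'l::finite) \<Rightarrow> ('l \<Rightarrow> real^'m \<Rightarrow> real) \<Rightarrow> real^'m^'n
    \<Rightarrow> real \<Rightarrow> bool" where
  "quadratic_growth g blk \<xi> X \<mu> \<longleftrightarrow>
     (\<forall>a. dual g blk \<xi> X a - dual_opt g blk \<xi> X
        \<ge> ereal (\<mu> / 2) * (INF b \<in> dual_solutions g blk \<xi> X. ereal ((norm (a - b))\<^sup>2)))"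

definition subproblem ::
  "(real^'n \<Rightarrow> ereal) \<Rightarrow> ('m \<Rightarrow> 'l::finite) \<Rightarrow> ('l \<Rightarrow> real^'m \<Rightarrow> real) \<Rightarrow> real^'m^'n
    \<Rightarrow> real^'m \<Rightarrow> real^'m^'m \<Rightarrow> real^'m \<Rightarrow> ereal" where
  "subproblem g blk \<xi> X a B d =
     ereal (grad_G_conj g X a \<bullet> d + 1 / 2 * (d \<bullet> (B *v d))) + xi_conj blk \<xi> (- a - d)"

definition solves_approximately :: "real \<Rightarrow> (real^'m \<Rightarrow> ereal) \<Rightarrow> real^'m \<Rightarrow> bool" where
  "solves_approximately \<gamma> Q d \<longleftrightarrow> Q d - (INF e. Q e) \<le> ereal \<gamma> * (Q 0 - (INF e. Q e))"

definition predicted_change ::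
  "(real^'n \<Rightarrow> ereal) \<Rightarrow> ('m \<Rightarrow> 'l::finite) \<Rightarrow> ('l \<Rightarrow> real^'m \<Rightarrow> real) \<Rightarrow> real^'m^'n
    \<Rightarrow> real^'m \<Rightarrow> real^'m \<Rightarrow> ereal" where
  "predicted_change g blk \<xi> X a d =
     ereal (grad_G_conj g X a \<bullet> d) + xi_conj blk \<xi> (- a - d) - xi_conj blk \<xi> (- a)"

definition sufficient_decrease ::
  "(real^'n \<Rightarrow> ereal) \<Rightarrow> ('m \<Rightarrow> 'l::finite) \<Rightarrow> ('l \<Rightarrow> real^'m \<Rightarrow> real) \<Rightarrow> real^'m^'n
    \<Rightarrow> real \<Rightarrow> real^'m \<Rightarrow> real^'m \<Rightarrow> real \<Rightarrow> bool" where
  "sufficient_decrease g blk \<xi> X \<tau> a d \<eta> \<longleftrightarrow>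
     dual g blk \<xi> X (a + \<eta> *\<^sub>R d)
       \<le> dual g blk \<xi> X a + ereal (\<eta> * \<tau>) * predicted_change g blk \<xi> X a d"

definition backtracking_step ::
  "(real^'n \<Rightarrow> ereal) \<Rightarrow> ('m \<Rightarrow> 'l::finite) \<Rightarrow> ('l \<Rightarrow> real^'m \<Rightarrow> real) \<Rightarrow> real^'m^'n
    \<Rightarrow> real \<Rightarrow> real \<Rightarrow> real^'m \<Rightarrow> real^'m \<Rightarrow> real \<Rightarrow> bool" where
  "backtracking_step g blk \<xi> X \<beta> \<tau> a d \<eta> \<longleftrightarrow>
     \<eta> = \<beta> ^ (LEAST i. sufficient_decrease g blk \<xi> X \<tau> a d (\<beta> ^ i))"

definition exact_step ::
  "(real^'n \<Rightarrow> ereal) \<Rightarrow> ('m \<Rightarrow> 'l::finite) \<Rightarrow> ('l \<Rightarrow> real^'m \<Rightarrow> real) \<Rightarrow> real^'m^'n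
    \<Rightarrow> real^'m \<Rightarrow> real^'m \<Rightarrow> real \<Rightarrow> bool" where
  "exact_step g blk \<xi> X a d \<eta> \<longleftrightarrow>
     is_arg_min (\<lambda>e. dual g blk \<xi> X (a + e *\<^sub>R d)) (\<lambda>_. True) \<eta>"

end

theory Submission
  imports Defs
begin

text \<open>
  Let \<open>D\<close> be the gap between \<open>Q(0)\<close> and the infimum of the model \<open>Q\<close> at \<open>\<alpha>\<^sup>t\<close>. Strong convexity of
  \<open>Q\<close> and the \<open>\<gamma>\<close>-approximation bound the predicted change \<open>\<Delta>\<close> in two ways: \<open>\<Delta> \<le> -(1 - \<gamma>) D\<close>, and
  \<open>-\<Delta>\<close> is at least a multiple of \<open>\<parallel>\<Delta>\<alpha>\<parallel>\<^sup>2\<close>. Since \<open>g\<^sup>*\<close> has a \<open>(1/\<sigma>)\<close>-Lipschitz gradient, the second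
  bound makes all small steps acceptable to the line search, whence the objective drops by at least
  \<open>\<tau> m D\<close>. Testing \<open>Q\<close> at \<open>u (b - \<alpha>\<^sup>t)\<close>, where \<open>b\<close> is a (nearly) closest dual solution, and using
  quadratic growth gives \<open>D \<ge> (u - u\<^sup>2 C\<^sub>3 / \<mu>) (f(\<alpha>\<^sup>t) - f\<^sup>*)\<close> for \<open>u \<in> [0, 1]\<close>; the two cases of the
  rate come from maximizing over \<open>u\<close>.
\<close>

section \<open>Strongly convex extended-valued functions and their conjugates\<close>

text \<open>Real bounds on the three values keep later arguments free of case distinctions on
  infinite values.\<close>

lemma strongly_convexD:
  assumes "strongly_convex s h" "0 < u" "u < 1"
    and "h x \<le> ereal a" "h y \<le> ereal b" "ereal c \<le> h ((1 - u) *\<^sub>R x + u *\<^sub>R y)"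
  shows "c + s / 2 * (1 - u) * u * (norm (x - y))\<^sup>2 \<le> (1 - u) * a + u * b"
proof -
  have "ereal (c + s / 2 * (1 - u) * u * (norm (x - y))\<^sup>2)
      \<le> h ((1 - u) *\<^sub>R x + u *\<^sub>R y) + ereal (s / 2 * (1 - u) * u * (norm (x - y))\<^sup>2)"
    using assms(6) by (metis add_right_mono plus_ereal.simps(1))
  also have "\<dots> \<le> ereal (1 - u) * h x + ereal u * h y"
    using assms(1-3) unfolding strongly_convex_def by auto
  also have "\<dots> \<le> ereal (1 - u) * ereal a + ereal u * ereal b"
    using assms by (intro add_mono ereal_mult_left_mono) auto
  finally show ?thesis by simp
qed

text \<open>The added term is affine along segments, so the modulus \<open>s\<close> survives.
  Tilting by \<open>- u\<close> turns the conjugate at \<open>u\<close> into the negative of an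
  infimum.\<close>

lemma strongly_convex_add_linear:
  fixes h :: "'a::real_inner \<Rightarrow> ereal"
  assumes "strongly_convex s h" "\<And>x. h x \<noteq> -\<infinity>"
  shows "strongly_convex s (\<lambda>x. h x + ereal (x \<bullet> v))"
  unfolding strongly_convex_def
proof (intro allI ballI)
  fix x y :: 'a and u :: real assume u: "u \<in> {0<..<1}"
  let ?z = "(1 - u) *\<^sub>R x + u *\<^sub>R y"
  have "h ?z + ereal (s / 2 * (1 - u) * u * (norm (x - y))\<^sup>2) \<le> ereal (1 - u) * h x + ereal u * h y"
    using assms u unfolding strongly_convex_def by blast
  moreover have "?z \<bullet> v = (1 - u) * (x \<bullet> v) + u * (y \<bullet> v)"
    by (simp add: inner_left_distrib)
  ultimately show "h ?z + ereal (?z \<bullet> v) + ereal (s / 2 * (1 - u) * u * (norm (x - y))\<^sup>2)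
      \<le> ereal (1 - u) * (h x + ereal (x \<bullet> v)) + ereal u * (h y + ereal (y \<bullet> v))"
    using assms(2)[of x] assms(2)[of y] assms(2)[of ?z] u
    by (cases "h x"; cases "h y"; cases "h ?z") (auto simp: algebra_simps)
qed

text \<open>At the midpoint of \<open>x0\<close> and \<open>x\<close> the minorant falls only
  linearly in the distance \<open>r\<close>, while strong convexity contributes
  \<open>s / 8 * r\<^sup>2\<close>. Completing the square leaves the loss
  \<open>c\<^sup>2 / (2 * s)\<close>; the outer factor 2 undoes the weight 1/2 of
  \<open>h x\<close>.\<close>

lemma strongly_convex_bounded_below:
  fixes h :: "'a::real_inner \<Rightarrow> ereal"
  assumes sc: "strongly_convex s h" and s: "s > 0" and x0: "h x0 \<le> ereal a"
    and minorant: "\<And>x. ereal (- c * norm x - k) \<le> h x" and c: "c \<ge> 0"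
  obtains k' where "\<And>x. ereal k' \<le> h x"
proof
  fix x
  let ?k = "2 * (- c * norm x0 - k - a / 2 - c\<^sup>2 / (2 * s))"
  show "ereal ?k \<le> h x"
  proof (rule ereal_le_real)
    fix b assume b: "h x \<le> ereal b"
    define r where "r = norm (x0 - x)"
    define z where "z = (1 - 1/2) *\<^sub>R x0 + (1/2) *\<^sub>R x"
    have z: "(1 - 1/2) *\<^sub>R x0 + (1/2) *\<^sub>R x = z" by (simp add: z_def)
    have "z = x0 - (1/2) *\<^sub>R (x0 - x)" by (simp add: z_def algebra_simps flip: scaleR_add_left)
    then have "norm z \<le> norm x0 + r / 2" unfolding r_def
      using norm_triangle_ineq4[of x0 "(1/2) *\<^sub>R (x0 - x)"] by simp
    then have "c * norm z \<le> c * (norm x0 + r / 2)" using c by (rule mult_left_mono)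
    moreover have "ereal (- c * norm z - k) \<le> h ((1 - 1/2) *\<^sub>R x0 + (1/2) *\<^sub>R x)"
      unfolding z by (rule minorant)
    then have "(- c * norm z - k) + s / 2 * (1 - 1/2) * (1/2) * (norm (x0 - x))\<^sup>2
        \<le> (1 - 1/2) * a + 1/2 * b"
      by (intro strongly_convexD[OF sc _ _ x0 b]) auto
    moreover have "s / 8 * r\<^sup>2 - c * r / 2 \<ge> - c\<^sup>2 / (2 * s)"
    proof -
      have "0 \<le> (s * r - 2 * c)\<^sup>2 / (8 * s)" using s by simp
      also have "\<dots> = s / 8 * r\<^sup>2 - c * r / 2 + c\<^sup>2 / (2 * s)"
        using s by (simp add: field_simps power2_eq_square)
      finally show ?thesis by simp
    qed
    ultimately show "ereal ?k \<le> ereal b" by (simp add: r_def algebra_simps)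
  qed
qed

text \<open>The infimum need not be attained, since \<open>h\<close> is not assumed to be lower semicontinuous; the point
  \<open>x\<close> is the limit of a minimizing sequence, which strong convexity makes Cauchy.\<close>

lemma strongly_convex_minimizer:
  fixes h :: "'a::{real_inner,complete_space} \<Rightarrow> ereal"
  assumes sc: "strongly_convex s h" and s: "s > 0" and dom: "h x0 < \<infinity>"
    and bounded: "\<And>x. ereal k \<le> h x"
  obtains x m where "(INF y. h y) = ereal m"
    "\<And>y. ereal (m + s / 2 * (norm (y - x))\<^sup>2) \<le> h y"
    "\<And>e. e > 0 \<Longrightarrow> \<exists>y. norm (y - x) < e \<and> h y < ereal (m + e)"
proof -
  have "ereal k \<le> (INF y. h y)" using bounded by (intro INF_greatest) auto
  moreover have "(INF y. h y) < \<infinity>" using dom by (meson INF_lower UNIV_I le_less_trans)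
  ultimately obtain m where m: "(INF y. h y) = ereal m" by (cases "INF y. h y") auto
  have m_le: "ereal m \<le> h y" for y using INF_lower[of y UNIV h] m by simp
  have near: "\<exists>y. h y < ereal (m + e)" if "e > 0" for e
  proof -
    have "(INF y. h y) < ereal (m + e)" using m that by simp
    then show ?thesis by (auto simp: INF_less_iff)
  qed
  then have "\<forall>n. \<exists>y. h y < ereal (m + inverse (real (Suc n)))" by simp
  then obtain Y where Y: "\<And>n. h (Y n) < ereal (m + inverse (real (Suc n)))" by metis
  let ?i = "\<lambda>n. inverse (real (Suc n))"
  have diff: "s / 4 * (norm (Y i - Y j))\<^sup>2 \<le> ?i i + ?i j" for i j
  proof -
    \<comment> \<open>The midpoint of \<open>Y i\<close> and \<open>Y j\<close> still has value at
      least \<open>m\<close>, while both ends are nearly at \<open>m\<close>, so little room is left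
      for the strong convexity term.\<close>
    have "m + s / 2 * (1 - 1/2) * (1/2) * (norm (Y i - Y j))\<^sup>2
        \<le> (1 - 1/2) * (m + ?i i) + 1/2 * (m + ?i j)"
      by (rule strongly_convexD[OF sc]) (use Y[THEN less_imp_le] m_le in auto)
    then show ?thesis by (simp only: ring_distribs)
  qed
  have "Cauchy Y"
  proof (rule CauchyI)
    fix e :: real assume e: "e > 0"
    obtain N where N: "inverse (real (Suc N)) < s / 8 * e\<^sup>2"
      using reals_Archimedean[of "s / 8 * e\<^sup>2"] e s by auto
    have "norm (Y i - Y j) < e" if "i \<ge> N" "j \<ge> N" for i j
    proof -
      have "?i i \<le> ?i N" "?i j \<le> ?i N" using that by (auto intro!: le_imp_inverse_le)
      then have "s / 4 * (norm (Y i - Y j))\<^sup>2 < s / 4 * e\<^sup>2" using diff[of i j] N by linarith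
      then show ?thesis using s e by (simp add: power2_less_imp_less)
    qed
    then show "\<exists>M. \<forall>m\<ge>M. \<forall>n\<ge>M. norm (Y m - Y n) < e" by blast
  qed
  then obtain x where x: "Y \<longlonglongrightarrow> x" using Cauchy_convergent convergent_def by blast
  have i0: "?i \<longlonglongrightarrow> 0" by (rule LIMSEQ_inverse_real_of_nat)
  show thesis
  proof (rule that[OF m])
    fix y
    show "ereal (m + s / 2 * (norm (y - x))\<^sup>2) \<le> h y"
    proof (rule ereal_le_real)
      fix b assume b: "h y \<le> ereal b"
      \<comment> \<open>Strong convexity is applied between \<open>Y n\<close> and \<open>y\<close>
        and the limit is taken in the inequality, because \<open>h x\<close> itself could exceed
        \<open>m\<close>.\<close>
      have *: "m + s / 2 * (1 - u) * u * (norm (x - y))\<^sup>2 \<le> (1 - u) * m + u * b"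
        if u: "0 < u" "u < 1" for u
      proof (rule LIMSEQ_le)
        show "(\<lambda>n. m + s / 2 * (1 - u) * u * (norm (Y n - y))\<^sup>2)
            \<longlonglongrightarrow> m + s / 2 * (1 - u) * u * (norm (x - y))\<^sup>2"
          using x by (intro tendsto_intros)
        have "(\<lambda>n. (1 - u) * (m + ?i n) + u * b) \<longlonglongrightarrow> (1 - u) * (m + 0) + u * b"
          using i0 by (intro tendsto_intros)
        then show "(\<lambda>n. (1 - u) * (m + ?i n) + u * b) \<longlonglongrightarrow> (1 - u) * m + u * b" by simp
        show "\<exists>N. \<forall>n\<ge>N. m + s / 2 * (1 - u) * u * (norm (Y n - y))\<^sup>2
            \<le> (1 - u) * (m + ?i n) + u * b"
          using strongly_convexD[OF sc u Y[THEN less_imp_le] b m_le] by blast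
      qed
      \<comment> \<open>Dividing by \<open>u\<close> and then letting \<open>u\<close> tend to 0
        recovers the full coefficient \<open>s / 2\<close>.\<close>
      have "m + s / 2 * (1 - u) * (norm (y - x))\<^sup>2 \<le> b" if u: "0 < u" "u < 1" for u
      proof -
        have "u * (m + s / 2 * (1 - u) * (norm (y - x))\<^sup>2) \<le> u * b"
          using *[OF u] by (simp add: algebra_simps norm_minus_commute)
        then show ?thesis using u by simp
      qed
      then have "\<forall>\<^sub>F u in at_right (0::real). m + s / 2 * (1 - u) * (norm (y - x))\<^sup>2 \<le> b"
        by (auto simp: eventually_at_right_field intro!: exI[of _ 1])
      moreover have "((\<lambda>u. m + s / 2 * (1 - u) * (norm (y - x))\<^sup>2)
          \<longlongrightarrow> m + s / 2 * (1 - 0) * (norm (y - x))\<^sup>2) (at_right 0)"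
        by (intro tendsto_intros)
      ultimately have "m + s / 2 * (1 - 0) * (norm (y - x))\<^sup>2 \<le> b"
        by (intro tendsto_upperbound) auto
      then show "ereal (m + s / 2 * (norm (y - x))\<^sup>2) \<le> ereal b" by simp
    qed
  next
    fix e :: real assume e: "e > 0"
    have "\<forall>\<^sub>F n in sequentially. norm (Y n - x) < e"
      using x e by (auto simp: tendsto_iff dist_norm)
    moreover have "\<forall>\<^sub>F n in sequentially. ?i n < e"
      using order_tendstoD(2)[OF i0 e] .
    ultimately have "\<forall>\<^sub>F n in sequentially. norm (Y n - x) < e \<and> ?i n < e"
      by (rule eventually_conj)
    then obtain n where n: "norm (Y n - x) < e" "?i n < e"
      using eventually_happens'[OF sequentially_bot] by blast
    have "ereal (m + ?i n) \<le> ereal (m + e)" using n by simp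
    with Y[of n] n show "\<exists>y. norm (y - x) < e \<and> h y < ereal (m + e)"
      using less_le_trans by blast
  qed
qed

text \<open>Otherwise some points \<open>Y n\<close> of \<open>K\<close> have values below
  \<open>- n\<close>. At a limit point \<open>x\<close>, closedness puts \<open>(x, b)\<close> into
  the epigraph for every real \<open>b\<close>, which forces the excluded value
  \<open>-\<infinity>\<close>.\<close>

lemma closed_epigraph_bounded_below:
  fixes h :: "'a::heine_borel \<Rightarrow> ereal"
  assumes cl: "closed (ereal_epigraph h)" and ninf: "\<And>x. h x \<noteq> -\<infinity>" and K: "compact K"
  obtains k where "\<And>x. x \<in> K \<Longrightarrow> ereal k \<le> h x"
proof (rule ccontr)
  assume "\<not> thesis"
  then have "\<forall>k. \<exists>x\<in>K. h x < ereal k" using that by (meson not_less)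
  then have "\<forall>n::nat. \<exists>x\<in>K. h x < ereal (- real n)" by blast
  then obtain Y where Y: "\<And>n. Y n \<in> K" "\<And>n::nat. h (Y n) < ereal (- real n)" by metis
  obtain x r where x: "x \<in> K" "strict_mono r" "(Y \<circ> r) \<longlonglongrightarrow> x"
    using K Y(1) by (metis compact_eq_seq_compact_metric seq_compactE)
  have "h x \<le> ereal b" for b
  proof -
    obtain N where N: "- b \<le> real N" using real_arch_simple by blast
    have "(\<lambda>n. ((Y \<circ> r) n, b)) \<longlonglongrightarrow> (x, b)" using x(3) by (intro tendsto_intros)
    moreover have "\<forall>\<^sub>F n in sequentially. ((Y \<circ> r) n, b) \<in> ereal_epigraph h"
    proof (rule eventually_sequentiallyI)
      fix n assume "N \<le> n"
      then have "N \<le> r n" using x(2) by (meson le_trans seq_suble)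
      then have "ereal (- real (r n)) \<le> ereal b" using N by simp
      with Y(2)[of "r n"] have "h (Y (r n)) \<le> ereal b" by (meson less_imp_le order_trans)
      then show "((Y \<circ> r) n, b) \<in> ereal_epigraph h" by (simp add: ereal_epigraph_def)
    qed
    ultimately have "(x, b) \<in> ereal_epigraph h"
      using cl Lim_in_closed_set[OF cl] by (metis trivial_limit_sequentially)
    then show ?thesis by (simp add: ereal_epigraph_def)
  qed
  then have "h x = -\<infinity>" by (rule ereal_bot)
  with ninf show False by blast
qed

text \<open>A lower bound \<open>k\<close> on the unit ball around \<open>x0\<close> propagates
  outwards: for \<open>x\<close> at distance \<open>r > 1\<close>, the segment from
  \<open>x0\<close> to \<open>x\<close> meets the sphere at \<open>z\<close>, and convexity at
  \<open>z\<close> bounds \<open>h x\<close> below with slope \<open>a - k\<close> in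
  \<open>r\<close>.\<close>

lemma strongly_convex_norm_minorant:
  fixes h :: "'a::{real_inner,heine_borel} \<Rightarrow> ereal"
  assumes sc: "strongly_convex s h" and s: "s > 0" and proper: "proper_fun h"
    and cl: "closed (ereal_epigraph h)"
  obtains c k where "c \<ge> 0" "\<And>x. ereal (- c * norm x - k) \<le> h x"
proof -
  have ninf: "h x \<noteq> -\<infinity>" for x using proper by (auto simp: proper_fun_def)
  obtain x0 a where x0: "h x0 = ereal a"
    using proper ninf unfolding proper_fun_def edom_def
    by (metis (no_types, lifting) all_not_in_conv ereal_infty_less(1) mem_Collect_eq real_of_ereal.cases)
  obtain k0 where "\<And>x. x \<in> cball x0 1 \<Longrightarrow> ereal k0 \<le> h x"
    using closed_epigraph_bounded_below[OF cl ninf compact_cball] by blast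
  moreover define k where "k = min k0 a"
  ultimately have k: "ereal k \<le> h x" if "x \<in> cball x0 1" for x
    using that by (metis ereal_less_eq(3) min.cobounded1 order_trans)
  show thesis
  proof (rule that)
    show "0 \<le> a - k" by (simp add: k_def)
    fix x
    show "ereal (- (a - k) * norm x - ((a - k) * norm x0 + (a - k) - a)) \<le> h x"
    proof (rule ereal_le_real)
      fix b assume b: "h x \<le> ereal b"
      define r where "r = norm (x0 - x)"
      have r: "r \<le> norm x0 + norm x" unfolding r_def by (rule norm_triangle_ineq4)
      have ak: "0 \<le> a - k" by (simp add: k_def)
      have "a - (a - k) * (r + 1) \<le> b"
      proof (cases "r \<le> 1")
        case True
        then have "k \<le> b" using k[of x] b
          by (metis r_def dist_norm ereal_less_eq(3) mem_cball order_trans)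
        moreover have "0 \<le> (a - k) * r" using ak by (simp add: r_def)
        ultimately show ?thesis by (simp add: algebra_simps)
      next
        case False
        then have r1: "r > 1" by simp
        define z where "z = (1 - 1 / r) *\<^sub>R x0 + (1 / r) *\<^sub>R x"
        have "x0 - z = (1 / r) *\<^sub>R (x0 - x)" by (simp add: z_def algebra_simps)
        then have "z \<in> cball x0 1" using r1 by (simp add: dist_norm r_def)
        then have "k + s / 2 * (1 - 1 / r) * (1 / r) * (norm (x0 - x))\<^sup>2 \<le> (1 - 1 / r) * a + 1 / r * b"
          using r1 k b x0 by (intro strongly_convexD[OF sc]) (auto simp: z_def)
        moreover have "0 \<le> s / 2 * (1 - 1 / r) * (1 / r) * (norm (x0 - x))\<^sup>2" using r1 s by simp
        ultimately have "k \<le> (1 - 1 / r) * a + 1 / r * b" by linarith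
        then have "k * r \<le> ((1 - 1 / r) * a + 1 / r * b) * r" using r1 by (intro mult_right_mono) auto
        moreover have "((1 - 1 / r) * a + 1 / r * b) * r = (r - 1) * a + b"
          using r1 by (simp add: field_simps)
        ultimately have "k * r \<le> (r - 1) * a + b" by simp
        then show ?thesis using ak by (simp add: algebra_simps)
      qed
      moreover have "(a - k) * (r + 1) \<le> (a - k) * (norm x0 + norm x + 1)"
        using ak r by (intro mult_left_mono) auto
      ultimately show "ereal (- (a - k) * norm x - ((a - k) * norm x0 + (a - k) - a)) \<le> ereal b"
        by (simp add: algebra_simps)
    qed
  qed
qed

text \<open>The Fenchel-Young inequality, with \<open>a\<close> any real upper bound of
  \<open>h z\<close>.\<close>

lemma conjugate_upper:
  fixes h :: "'a::real_inner \<Rightarrow> ereal"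
  assumes "h z \<le> ereal a"
  shows "ereal (z \<bullet> u - a) \<le> conjugate h u"
proof -
  have "ereal (z \<bullet> u - a) \<le> ereal (z \<bullet> u) - h z"
    using assms by (cases "h z") auto
  also have "\<dots> \<le> conjugate h u" unfolding conjugate_on_def
    using assms by (intro SUP_upper) (auto simp: edom_def)
  finally show ?thesis .
qed

lemma conjugate_least:
  fixes h :: "'a::real_inner \<Rightarrow> ereal"
  assumes "\<And>z. h z \<noteq> -\<infinity>" "\<And>z a. h z = ereal a \<Longrightarrow> z \<bullet> u - a \<le> c"
  shows "conjugate h u \<le> ereal c"
  unfolding conjugate_on_def
proof (rule SUP_least)
  fix z assume "z \<in> UNIV \<inter> edom h"
  then show "ereal (z \<bullet> u) - h z \<le> ereal c" using assms[of z]
    by (cases "h z") (auto simp: edom_def)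
qed

lemma inner_le_weighted_squares:
  fixes x y :: "'a::real_inner"
  assumes "s > 0"
  shows "x \<bullet> y \<le> s / 2 * (norm x)\<^sup>2 + (norm y)\<^sup>2 / (2 * s)"
proof -
  have "0 \<le> (s * norm x - norm y)\<^sup>2 / (2 * s)" using assms by simp
  also have "\<dots> = s / 2 * (norm x)\<^sup>2 - norm x * norm y + (norm y)\<^sup>2 / (2 * s)"
    using assms by (simp add: power2_diff field_simps power2_eq_square)
  finally show ?thesis using norm_cauchy_schwarz[of x y] by linarith
qed

text \<open>\<open>- G u\<close> is the infimum of \<open>h\<close> tilted by \<open>- u\<close>,
  and \<open>w u\<close> is the limit of its minimizing sequences. The bounds say that
  \<open>w u\<close> is a subgradient of \<open>G\<close> and that \<open>G\<close> is smooth with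
  constant \<open>1 / s\<close>; this is the form in which the Lipschitz gradient of the conjugate
  is used.\<close>

lemma conjugate_strongly_convex_bounds:
  fixes h :: "'a::euclidean_space \<Rightarrow> ereal"
  assumes sc: "strongly_convex s h" and s: "s > 0" and proper: "proper_fun h"
    and cl: "closed (ereal_epigraph h)"
  obtains G w where "\<And>u. conjugate h u = ereal (G u)"
    "\<And>u v. G u + w u \<bullet> v \<le> G (u + v)"
    "\<And>u v. G (u + v) \<le> G u + w u \<bullet> v + (norm v)\<^sup>2 / (2 * s)"
proof -
  have ninf: "h x \<noteq> -\<infinity>" for x using proper by (auto simp: proper_fun_def)
  obtain x0 a where x0: "h x0 = ereal a"
    using proper ninf unfolding proper_fun_def edom_def
    by (metis (no_types, lifting) all_not_in_conv ereal_infty_less(1) mem_Collect_eq real_of_ereal.cases)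
  obtain c k where ck: "c \<ge> 0" "\<And>x. ereal (- c * norm x - k) \<le> h x"
    using strongly_convex_norm_minorant[OF sc s proper cl] by blast
  have "\<exists>m x. conjugate h u = ereal (- m) \<and>
      (\<forall>y b. h y = ereal b \<longrightarrow> m + s / 2 * (norm (y - x))\<^sup>2 \<le> b - y \<bullet> u) \<and>
      (\<forall>e>0. \<exists>y b. norm (y - x) < e \<and> h y = ereal b \<and> b - y \<bullet> u < m + e)" for u
  proof -
    let ?h = "\<lambda>x. h x + ereal (x \<bullet> (- u))"
    have sc': "strongly_convex s ?h" by (rule strongly_convex_add_linear[OF sc ninf])
    have min: "ereal (- (c + norm u) * norm x - k) \<le> ?h x" for x
    proof -
      have "x \<bullet> u \<le> norm u * norm x" using norm_cauchy_schwarz[of x u] by (simp add: mult.commute)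
      then show ?thesis using ck(2)[of x] by (cases "h x") (auto simp: algebra_simps)
    qed
    obtain k' where k': "\<And>x. ereal k' \<le> ?h x"
      by (rule strongly_convex_bounded_below[OF sc' s, of x0 "a - x0 \<bullet> u" "c + norm u" k])
        (use x0 min ck(1) in auto)
    obtain x m where xm: "(INF y. ?h y) = ereal m"
      "\<And>y. ereal (m + s / 2 * (norm (y - x))\<^sup>2) \<le> ?h y"
      "\<And>e. e > 0 \<Longrightarrow> \<exists>y. norm (y - x) < e \<and> ?h y < ereal (m + e)"
      by (rule strongly_convex_minimizer[OF sc' s _ k', of x0]) (use x0 in auto)
    have low: "m + s / 2 * (norm (y - x))\<^sup>2 \<le> b - y \<bullet> u" if "h y = ereal b" for y b
      using xm(2)[of y] that by simp
    have app: "\<exists>y b. norm (y - x) < e \<and> h y = ereal b \<and> b - y \<bullet> u < m + e" if "e > 0" for e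
    proof -
      obtain y where y: "norm (y - x) < e" "?h y < ereal (m + e)" using xm(3) \<open>e > 0\<close> by blast
      with ninf[of y] show ?thesis by (cases "h y") auto
    qed
    have "conjugate h u \<le> ereal (- m)"
    proof (rule conjugate_least[OF ninf])
      fix z b assume "h z = ereal b"
      from low[OF this] s show "z \<bullet> u - b \<le> - m"
        by (smt (verit) mult_nonneg_nonneg zero_le_power2 divide_nonneg_nonneg)
    qed
    moreover have "ereal (- m) \<le> conjugate h u"
    proof (rule ereal_le_epsilon2)
      fix e :: real assume "0 < e"
      then obtain y b where "h y = ereal b" "b - y \<bullet> u < m + e" using app by blast
      then show "ereal (- m) \<le> conjugate h u + ereal e"
        using conjugate_upper[of h y b u] by (cases "conjugate h u") auto
    qed
    ultimately have "conjugate h u = ereal (- m)" by (rule antisym)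
    with low app show ?thesis by blast
  qed
  then obtain m w where mw: "\<And>u. conjugate h u = ereal (- m u)"
    "\<And>u y b. h y = ereal b \<Longrightarrow> m u + s / 2 * (norm (y - w u))\<^sup>2 \<le> b - y \<bullet> u"
    "\<And>u e. e > 0 \<Longrightarrow> \<exists>y b. norm (y - w u) < e \<and> h y = ereal b \<and> b - y \<bullet> u < m u + e"
    by metis
  show thesis
  proof (rule that[of "\<lambda>u. - m u" w])
    show "conjugate h u = ereal (- m u)" for u by (rule mw)
    fix u v
    show "- m u + w u \<bullet> v \<le> - m (u + v)"
    proof (rule field_le_epsilon)
      fix e :: real assume e: "0 < e"
      \<comment> \<open>The total error is \<open>d\<close> from near-minimality of \<open>y\<close>
        plus \<open>d * norm v\<close> from its distance to \<open>w u\<close>; this choice makes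
        the sum \<open>e\<close>.\<close>
      define d where "d = e / (1 + norm v)"
      have d: "d > 0" "d * (1 + norm v) = e"
        using e by (auto simp: d_def add_pos_nonneg divide_simps) (smt (verit) norm_ge_zero)+
      obtain y b where y: "norm (y - w u) < d" "h y = ereal b" "b - y \<bullet> u < m u + d"
        using mw(3)[OF d(1)] by blast
      have "ereal (y \<bullet> (u + v) - b) \<le> ereal (- m (u + v))"
        using conjugate_upper[of h y b "u + v"] y(2) mw(1) by simp
      moreover have "(w u - y) \<bullet> v \<le> d * norm v"
        using norm_cauchy_schwarz[of "w u - y" v] y(1) mult_right_mono[of "norm (w u - y)" d "norm v"]
        by (simp add: norm_minus_commute)
      ultimately show "- m u + w u \<bullet> v \<le> - m (u + v) + e"
        using y(3) d(2) by (simp add: algebra_simps)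
    qed
    \<comment> \<open>Moving from \<open>u\<close> to \<open>u + v\<close> gains
      \<open>(y - w u) \<bullet> v\<close> beyond the linear term; Young's inequality splits it, and
      the growth of the tilted function around \<open>w u\<close> absorbs the square of
      \<open>y - w u\<close>.\<close>
    have "conjugate h (u + v) \<le> ereal (- m u + w u \<bullet> v + (norm v)\<^sup>2 / (2 * s))"
    proof (rule conjugate_least[OF ninf])
      fix y b assume y: "h y = ereal b"
      have "(y - w u) \<bullet> v \<le> s / 2 * (norm (y - w u))\<^sup>2 + (norm v)\<^sup>2 / (2 * s)"
        by (rule inner_le_weighted_squares[OF s])
      with mw(2)[OF y, of u] show "y \<bullet> (u + v) - b \<le> - m u + w u \<bullet> v + (norm v)\<^sup>2 / (2 * s)"
        by (simp add: algebra_simps)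
    qed
    then show "- m (u + v) \<le> - m u + w u \<bullet> v + (norm v)\<^sup>2 / (2 * s)" using mw(1) by simp
  qed
qed

lemma conjugate_convex:
  fixes h :: "'a::real_inner \<Rightarrow> ereal"
  assumes "\<And>z. h z \<noteq> -\<infinity>" "0 \<le> t" "t \<le> 1" "conjugate h u \<le> ereal a" "conjugate h v \<le> ereal b"
  shows "conjugate h ((1 - t) *\<^sub>R u + t *\<^sub>R v) \<le> ereal ((1 - t) * a + t * b)"
proof (rule conjugate_least[OF assms(1)])
  fix z c assume "h z = ereal c"
  then have "ereal (z \<bullet> u - c) \<le> ereal a" "ereal (z \<bullet> v - c) \<le> ereal b"
    using conjugate_upper[of h z c] assms(4,5) order_trans by (metis order_refl)+
  then have "(1 - t) * (z \<bullet> u - c) + t * (z \<bullet> v - c) \<le> (1 - t) * a + t * b"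
    using assms(2,3) by (intro add_mono mult_left_mono) auto
  then show "z \<bullet> ((1 - t) *\<^sub>R u + t *\<^sub>R v) - c \<le> (1 - t) * a + t * b"
    by (simp add: inner_right_distrib algebra_simps)
qed

section \<open>Gradients and matrices\<close>

lemma gradient_eqI:
  assumes "GDERIV h x :> D"
  shows "gradient h x = D"
  unfolding gradient_def
proof (rule the_equality[where P = "\<lambda>D. GDERIV h x :> D", OF assms])
  fix D' assume "GDERIV h x :> D'"
  with assms have "(\<lambda>v. v \<bullet> D') = (\<lambda>v. v \<bullet> D)"
    unfolding gderiv_def using has_derivative_unique by blast
  then have "(D' - D) \<bullet> D' = (D' - D) \<bullet> D" by meson
  then have "(D' - D) \<bullet> (D' - D) = 0" by (simp add: inner_diff_right)
  then show "D' = D" by simp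
qed

text \<open>The bounds trap the first-order remainder between 0 and
  \<open>c * (norm d)\<^sup>2\<close>, which is of smaller order than \<open>norm d\<close>.\<close>

lemma gradient_quadratic_bounds:
  fixes f :: "'a::real_inner \<Rightarrow> real"
  assumes lower: "\<And>d. f x + D \<bullet> d \<le> f (x + d)"
    and upper: "\<And>d. f (x + d) \<le> f x + D \<bullet> d + c * (norm d)\<^sup>2"
  shows "gradient f x = D"
proof (rule gradient_eqI)
  have "(\<lambda>h. (f (x + h) - f x - h \<bullet> D) / norm h) \<midarrow>0\<rightarrow> 0"
  proof (rule Lim_null_comparison)
    have "norm ((f (x + h) - f x - h \<bullet> D) / norm h) \<le> c * norm h" for h
    proof (cases "h = 0")
      case False
      have "\<bar>f (x + h) - f x - h \<bullet> D\<bar> \<le> c * (norm h)\<^sup>2"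
        using lower[of h] upper[of h] by (simp add: inner_commute)
      with False show ?thesis by (simp add: field_simps power2_eq_square)
    qed simp
    then show "\<forall>\<^sub>F h in at 0. norm ((f (x + h) - f x - h \<bullet> D) / norm h) \<le> c * norm h" by simp
    have "(\<lambda>h::'a. c * norm h) \<midarrow>0\<rightarrow> c * norm (0::'a)" by (intro tendsto_intros)
    then show "(\<lambda>h::'a. c * norm h) \<midarrow>0\<rightarrow> 0" by simp
  qed
  then have "(\<lambda>h. norm (f (x + h) - f x - h \<bullet> D) / norm h) \<midarrow>0\<rightarrow> 0"
    using tendsto_norm_zero by fastforce
  then show "GDERIV f x :> D"
    unfolding gderiv_def has_derivative_at by (simp add: bounded_linear_inner_left)
qed

section \<open>Spectral norms, quadratic forms and eigenvalues\<close>

lemma norm_matrix_vector_le: "norm (M *v v) \<le> spectral_norm M * norm v"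
  for M :: "real^'m^'n"
  unfolding spectral_norm_def by (intro onorm matrix_vector_mul_bounded_linear)

lemma quadratic_form_le_spectral_norm: "v \<bullet> (M *v v) \<le> spectral_norm M * (norm v)\<^sup>2"
  for M :: "real^'m^'m"
proof -
  have "v \<bullet> (M *v v) \<le> norm v * norm (M *v v)" by (rule norm_cauchy_schwarz)
  also have "\<dots> \<le> norm v * (spectral_norm M * norm v)"
    by (intro mult_left_mono norm_matrix_vector_le) simp
  finally show ?thesis by (simp add: power2_eq_square mult_ac)
qed

lemma inner_transpose_matrix: "(transpose M *v v) \<bullet> w = v \<bullet> (M *v w)"
  for M :: "real^'m^'n"
  by (simp add: dot_lmul_matrix)

lemma norm_matrix_vector_squared_le:
  "(norm (M *v v))\<^sup>2 \<le> spectral_norm (transpose M ** M) * (norm v)\<^sup>2"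
  for M :: "real^'m^'n"
proof -
  have "(norm (M *v v))\<^sup>2 = v \<bullet> ((transpose M ** M) *v v)"
    using inner_transpose_matrix[of M "M *v v" v]
    by (simp add: power2_norm_eq_inner inner_commute matrix_vector_mul_assoc[symmetric])
  then show ?thesis using quadratic_form_le_spectral_norm[of v "transpose M ** M"] by simp
qed

text \<open>This makes the quotient by \<open>spectral_norm (transpose X ** X)\<close> in the rate
  meaningful as soon as \<open>X\<close> is nonzero.\<close>

lemma spectral_norm_gram_pos:
  fixes M :: "real^'m^'n"
  assumes "M \<noteq> 0"
  shows "spectral_norm (transpose M ** M) > 0"
proof -
  obtain v where "M *v v \<noteq> 0" using assms by (metis matrix_eq matrix_vector_mult_0)
  then have "0 < (norm (M *v v))\<^sup>2" by simp
  also have "\<dots> \<le> spectral_norm (transpose M ** M) * (norm v)\<^sup>2"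
    by (rule norm_matrix_vector_squared_le)
  finally show ?thesis by (meson mult_nonpos_nonneg not_less zero_le_power2)
qed

text \<open>A minimizer \<open>w\<close> of the quadratic form on the unit sphere is an eigenvector: the form of
  \<open>M - k I\<close> is nonnegative and vanishes at \<open>w\<close>, so its gradient at \<open>w\<close> vanishes too.\<close>

lemma eigenvalue_lower_bound_quadratic_form:
  fixes M :: "real^'m^'m"
  assumes sym: "transpose M = M" and ev: "\<And>k. eigenvalue M k \<Longrightarrow> c \<le> k"
  shows "c * (norm v)\<^sup>2 \<le> v \<bullet> (M *v v)"
proof -
  have "continuous_on (sphere 0 1) (\<lambda>x. x \<bullet> (M *v x))"
    by (intro continuous_intros linear_continuous_on matrix_vector_mul_bounded_linear)
  moreover have "sphere (0::real^'m) 1 \<noteq> {}" by simp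
  ultimately obtain w where w: "w \<in> sphere 0 1" and
    min: "\<And>x. x \<in> sphere 0 1 \<Longrightarrow> w \<bullet> (M *v w) \<le> x \<bullet> (M *v x)"
    using continuous_attains_inf[OF compact_sphere] by blast
  define k where "k = w \<bullet> (M *v w)"
  have nw: "norm w = 1" using w by simp
  then have ww: "w \<bullet> w = 1" by (simp add: norm_eq_1)
  have form: "k * (norm x)\<^sup>2 \<le> x \<bullet> (M *v x)" for x
  proof (cases "x = 0")
    case False
    then have "k \<le> (inverse (norm x) *\<^sub>R x) \<bullet> (M *v (inverse (norm x) *\<^sub>R x))"
      unfolding k_def by (intro min) simp
    also have "\<dots> = (inverse (norm x))\<^sup>2 * (x \<bullet> (M *v x))"
      by (simp add: matrix_vector_mult_scaleR power2_eq_square)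
    finally show ?thesis using False by (simp add: field_simps)
  qed simp
  \<comment> \<open>Half the gradient at \<open>w\<close> of the form of M - k I; it is orthogonal
    to \<open>w\<close> because \<open>k\<close> is the value of the form of \<open>M\<close> at the
    unit vector \<open>w\<close>.\<close>
  define r where "r = M *v w - k *\<^sub>R w"
  have r_w: "r \<bullet> w = 0"
    using ww by (simp add: r_def inner_diff_left k_def inner_commute[of "M *v w" w])
  have "M *v w = k *\<^sub>R w"
  proof (rule ccontr)
    assume "M *v w \<noteq> k *\<^sub>R w"
    then have r: "r \<noteq> 0" by (simp add: r_def)
    have Mr: "w \<bullet> (M *v r) = r \<bullet> r"
    proof -
      have "w \<bullet> (M *v r) = (M *v w) \<bullet> r" using inner_transpose_matrix[of M w r] sym by simp
      also have "\<dots> = (r + k *\<^sub>R w) \<bullet> r" by (simp add: r_def)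
      finally show ?thesis using r_w by (simp add: inner_add_left inner_add_right inner_commute[of w r])
    qed
    have rM: "r \<bullet> (M *v w) = r \<bullet> r"
    proof -
      have "r \<bullet> (M *v w) = r \<bullet> (r + k *\<^sub>R w)" by (simp add: r_def)
      then show ?thesis using r_w by (simp only: inner_add_right) simp
    qed
    define E where "E = r \<bullet> (M *v r) - k * (r \<bullet> r)"
    \<comment> \<open>The form of M - k I at \<open>w - t *\<^sub>R r\<close>: it vanishes at
      \<open>t = 0\<close> with slope \<open>- 2 * (r \<bullet> r)\<close>, so it would be negative
      for small positive \<open>t\<close>.\<close>
    have nonneg: "0 \<le> E * t\<^sup>2 - 2 * (r \<bullet> r) * t" for t
    proof -
      have "k * (norm (w - t *\<^sub>R r))\<^sup>2 \<le> (w - t *\<^sub>R r) \<bullet> (M *v (w - t *\<^sub>R r))" by (rule form)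
      moreover have "(norm (w - t *\<^sub>R r))\<^sup>2 = 1 + t\<^sup>2 * (r \<bullet> r)"
        unfolding power2_norm_eq_inner using ww r_w
        by (simp add: inner_diff inner_commute[of w r] power2_eq_square)
      moreover have "(w - t *\<^sub>R r) \<bullet> (M *v (w - t *\<^sub>R r))
          = k - 2 * t * (r \<bullet> r) + t\<^sup>2 * (r \<bullet> (M *v r))"
        by (simp add: matrix_vector_mult_diff_distrib matrix_vector_mult_scaleR inner_diff Mr rM
            k_def power2_eq_square algebra_simps)
      ultimately show ?thesis by (simp add: E_def algebra_simps)
    qed
    \<comment> \<open>Small enough that \<open>E * T\<close> is at most
      \<open>r \<bullet> r\<close>, whatever the sign of \<open>E\<close>, against the required
      \<open>2 * (r \<bullet> r)\<close>.\<close>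
    define T where "T = (r \<bullet> r) / (\<bar>E\<bar> + 1)"
    have T: "T > 0" using r by (simp add: T_def add_nonneg_pos)
    have "0 \<le> (E * T - 2 * (r \<bullet> r)) * T" using nonneg[of T] by (simp add: power2_eq_square algebra_simps)
    then have "2 * (r \<bullet> r) \<le> E * T" using T by (simp add: zero_le_mult_iff)
    also have "\<dots> = (E / (\<bar>E\<bar> + 1)) * (r \<bullet> r)" by (simp add: T_def)
    also have "\<dots> \<le> 1 * (r \<bullet> r)" by (intro mult_right_mono) (auto simp: divide_le_eq)
    finally show False using r by simp
  qed
  then have "eigenvalue M k" using nw unfolding eigenvalue_def by (intro exI[of _ w]) auto
  then have "c * (norm v)\<^sup>2 \<le> k * (norm v)\<^sup>2" by (intro mult_right_mono ev) auto
  with form[of v] show ?thesis by simp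
qed

section \<open>The dual problem\<close>

lemma inner_block_part_right: "block_part blk i z \<bullet> block_part blk i u = block_part blk i z \<bullet> u"
  by (auto simp: inner_vec_def block_part_def intro!: sum.cong)

lemma inner_eq_sum_block_part:
  fixes blk :: "'m::finite \<Rightarrow> 'l::finite"
  shows "z \<bullet> u = (\<Sum>i\<in>UNIV. block_part blk i z \<bullet> block_part blk i u)"
proof -
  have "(\<Sum>i\<in>UNIV. block_part blk i z \<bullet> block_part blk i u)
      = (\<Sum>i\<in>UNIV. \<Sum>j\<in>UNIV. if blk j = i then z $ j * u $ j else 0)"
    by (auto simp: inner_vec_def block_part_def intro!: sum.cong)
  also have "\<dots> = (\<Sum>j\<in>UNIV. \<Sum>i\<in>UNIV. if blk j = i then z $ j * u $ j else 0)"
    by (rule sum.swap)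
  finally show ?thesis by (simp add: inner_vec_def)
qed

lemma block_part_block_space:
  "z \<in> block_space blk i \<Longrightarrow> block_part blk j z = (if j = i then z else 0)"
  by (auto simp: block_space_def block_part_def vec_eq_iff)

lemma xi_conj_not_MInfty: "xi_conj blk \<xi> u \<noteq> -\<infinity>"
  using conjugate_upper[of "\<lambda>z. ereal (block_sum blk \<xi> z)" 0 _ u] unfolding xi_conj_def by force

text \<open>The conjugate of a block-separable function is the sum of the block conjugates. Bounds
  for the blocks add up to one for the whole; conversely, a bound for the whole restricts to block
  \<open>i\<close> by setting the other blocks to 0, at the constant cost of the values
  \<open>\<xi> j 0\<close>.\<close>

lemma dual_feasible_iff: "a \<in> dual_feasible blk \<xi> \<longleftrightarrow> xi_conj blk \<xi> (- a) < \<infinity>"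
proof
  assume a: "a \<in> dual_feasible blk \<xi>"
  have "\<exists>c. \<forall>z\<in>block_space blk i. z \<bullet> (- block_part blk i a) - \<xi> i z \<le> c" for i
  proof -
    define s where "s = conjugate_on (block_space blk i) (\<lambda>z. ereal (\<xi> i z)) (- block_part blk i a)"
    have le: "ereal (z \<bullet> (- block_part blk i a) - \<xi> i z) \<le> s" if "z \<in> block_space blk i" for z
      unfolding s_def conjugate_on_def
      by (rule SUP_upper2[of z]) (use that in \<open>auto simp: edom_def\<close>)
    moreover have "s < \<infinity>" using a by (auto simp: dual_feasible_def edom_def s_def)
    moreover have "s \<noteq> -\<infinity>" using le[of 0] by (auto simp: block_space_def)
    ultimately show ?thesis by (cases s) auto
  qed
  then obtain c where c: "\<And>i z. z \<in> block_space blk i \<Longrightarrow> z \<bullet> (- block_part blk i a) - \<xi> i z \<le> c i"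
    by metis
  have "xi_conj blk \<xi> (- a) \<le> ereal (\<Sum>i\<in>UNIV. c i)"
    unfolding xi_conj_def
  proof (rule conjugate_least)
    fix z b assume b: "ereal (block_sum blk \<xi> z) = ereal b"
    have "z \<bullet> - a - b = (\<Sum>i\<in>UNIV. block_part blk i z \<bullet> (- block_part blk i a) - \<xi> i (block_part blk i z))"
      using b by (simp add: inner_eq_sum_block_part[of z a blk] block_sum_def sum_subtractf sum_negf)
    also have "\<dots> \<le> (\<Sum>i\<in>UNIV. c i)"
      by (intro sum_mono c) (auto simp: block_space_def block_part_def)
    finally show "z \<bullet> - a - b \<le> (\<Sum>i\<in>UNIV. c i)" .
  qed simp
  then show "xi_conj blk \<xi> (- a) < \<infinity>" using le_less_trans by fastforce
next
  assume "xi_conj blk \<xi> (- a) < \<infinity>"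
  then obtain c where c: "xi_conj blk \<xi> (- a) = ereal c"
    using xi_conj_not_MInfty[of blk \<xi> "- a"] by (cases "xi_conj blk \<xi> (- a)") auto
  have "conjugate_on (block_space blk i) (\<lambda>z. ereal (\<xi> i z)) (- block_part blk i a)
      \<le> ereal (c + (\<Sum>j\<in>UNIV - {i}. \<xi> j 0))" for i
    unfolding conjugate_on_def
  proof (rule SUP_least)
    fix z assume "z \<in> block_space blk i \<inter> edom (\<lambda>z. ereal (\<xi> i z))"
    then have part: "block_part blk j z = (if j = i then z else 0)" for j
      by (simp add: block_part_block_space)
    have "block_sum blk \<xi> z = \<xi> i z + (\<Sum>j\<in>UNIV - {i}. \<xi> j 0)"
      unfolding block_sum_def part by (subst sum.remove[of UNIV i]) auto
    moreover have "z \<bullet> block_part blk i a = z \<bullet> a"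
      using inner_block_part_right[of blk i z a] part[of i] by simp
    moreover have "ereal (z \<bullet> (- a) - block_sum blk \<xi> z) \<le> ereal c"
      using conjugate_upper[of "\<lambda>z. ereal (block_sum blk \<xi> z)" z _ "- a"] c unfolding xi_conj_def by auto
    ultimately show "ereal (z \<bullet> - block_part blk i a) - ereal (\<xi> i z)
        \<le> ereal (c + (\<Sum>j\<in>UNIV - {i}. \<xi> j 0))" by simp
  qed
  then have "conjugate_on (block_space blk i) (\<lambda>z. ereal (\<xi> i z)) (- block_part blk i a) < \<infinity>" for i
    by (rule le_less_trans) simp
  then show "a \<in> dual_feasible blk \<xi>" by (simp add: dual_feasible_def edom_def)
qed

section \<open>Consequences of the assumptions on the primal problem\<close>

lemma primal_eq: "primal g blk \<xi> X w = g w + ereal (block_sum blk \<xi> (transpose X *v w))"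
  by (simp add: primal_def block_sum_def)

lemma proper_fun_primalD: "proper_fun (primal g blk \<xi> X) \<Longrightarrow> proper_fun g"
  unfolding proper_fun_def primal_eq edom_def by auto

text \<open>The vertical shear \<open>?T\<close> is continuous, and the preimage of the primal
  epigraph under it is the epigraph of \<open>g\<close>.\<close>

lemma closed_epigraph_primalD:
  assumes cl: "closed (ereal_epigraph (primal g blk \<xi> X))"
    and cont: "continuous_on UNIV (block_sum blk \<xi>)"
  shows "closed (ereal_epigraph g)"
proof -
  let ?T = "\<lambda>(w, r). (w, r + block_sum blk \<xi> (transpose X *v w))"
  have "continuous_on UNIV (\<lambda>w. block_sum blk \<xi> (transpose X *v w))"
    by (rule continuous_on_compose2[OF cont linear_continuous_on[OF matrix_vector_mul_bounded_linear]])
      simp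
  then have "continuous_on UNIV (\<lambda>x. block_sum blk \<xi> (transpose X *v fst x))"
    by (rule continuous_on_compose2) (auto intro!: continuous_intros)
  then have "continuous_on UNIV ?T"
    unfolding case_prod_beta by (intro continuous_intros)
  then have "closed (?T -` ereal_epigraph (primal g blk \<xi> X))"
    using cl continuous_closed_vimage continuous_on_eq_continuous_at open_UNIV by blast
  moreover have "?T -` ereal_epigraph (primal g blk \<xi> X) = ereal_epigraph g"
  proof -
    have "g w + ereal x \<le> ereal (r + x) \<longleftrightarrow> g w \<le> ereal r" for w x r
      by (cases "g w") auto
    then show ?thesis by (auto simp: ereal_epigraph_def primal_eq)
  qed
  ultimately show ?thesis by simp
qed

text \<open>Fenchel-Young is applied to \<open>g\<close> at \<open>X *v a\<close> and to the loss at
  \<open>- a\<close>; the two inner products cancel by transposition.\<close>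

lemma weak_duality:
  assumes "primal g blk \<xi> X w \<le> ereal p" "g w \<noteq> -\<infinity>"
  shows "ereal (- p) \<le> dual g blk \<xi> X a"
proof -
  let ?s = "block_sum blk \<xi> (transpose X *v w)"
  obtain c where c: "g w = ereal c" "c + ?s \<le> p"
    using assms by (cases "g w") (auto simp: primal_eq)
  have "ereal (- p) \<le> ereal (w \<bullet> (X *v a) - c) + ereal ((transpose X *v w) \<bullet> (- a) - ?s)"
    using c(2) inner_transpose_matrix[of X w a] by simp
  also have "\<dots> \<le> dual g blk \<xi> X a"
    unfolding dual_def G_conj_def xi_conj_def using c(1) by (intro add_mono conjugate_upper) auto
  finally show ?thesis .
qed

section \<open>One step of the method\<close>

lemma xi_conj_norm_minorant:
  "\<exists>c k. 0 \<le> c \<and> (\<forall>u. ereal (- c * norm u - k) \<le> xi_conj blk \<xi> u)"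
proof -
  have "ereal (0 \<bullet> u - block_sum blk \<xi> 0) \<le> xi_conj blk \<xi> u" for u
    unfolding xi_conj_def by (rule conjugate_upper) simp
  then show ?thesis by (intro exI[of _ 0] exI[of _ "block_sum blk \<xi> 0"]) simp
qed

text \<open>Let \<open>x\<close> be the limit minimizer and \<open>D\<close> the gap at 0. Quadratic
  growth around \<open>x\<close> bounds its distance to 0 by \<open>sqrt (2 * D / C)\<close> and its
  distance to \<open>d\<close> by \<open>sqrt \<gamma>\<close> times that, and the triangle
  inequality bounds \<open>norm d\<close>.\<close>

lemma approximate_minimizer_bounds:
  fixes Q :: "real^'m \<Rightarrow> ereal"
  assumes sc: "strongly_convex C Q" and C: "C > 0" and Q0: "Q 0 = ereal q0"
    and minorant: "\<And>x. ereal (- c * norm x - k) \<le> Q x" "c \<ge> 0"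
    and \<gamma>: "0 \<le> \<gamma>" "\<gamma> < 1" and approx: "solves_approximately \<gamma> Q d"
  obtains q' D where "Q d = ereal q'" "q' \<le> q0 - (1 - \<gamma>) * D"
    "(1 - sqrt \<gamma>)\<^sup>2 * C / 2 * (norm d)\<^sup>2 \<le> (1 - \<gamma>)\<^sup>2 * D"
    "\<And>e. ereal (q0 - D) \<le> Q e"
proof -
  obtain k' where k': "\<And>x. ereal k' \<le> Q x"
    using strongly_convex_bounded_below[OF sc C _ minorant, of 0 q0] Q0 by auto
  obtain x m where xm: "(INF y. Q y) = ereal m"
    "\<And>y. ereal (m + C / 2 * (norm (y - x))\<^sup>2) \<le> Q y"
    by (rule strongly_convex_minimizer[OF sc C _ k', of 0]) (use Q0 in auto)
  define D where "D = q0 - m"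
  have appr: "Q d - ereal m \<le> ereal (\<gamma> * D)"
    using approx unfolding solves_approximately_def xm(1) Q0 by (simp add: D_def)
  then obtain q' where q': "Q d = ereal q'" using k'[of d] by (cases "Q d") auto
  have q'm: "q' - m \<le> \<gamma> * D" using appr q' by simp
  have x: "C / 2 * (norm x)\<^sup>2 \<le> D" using xm(2)[of 0] Q0 by (simp add: D_def)
  have dx: "C / 2 * (norm (d - x))\<^sup>2 \<le> \<gamma> * D" using xm(2)[of d] q'm q' by simp
  have D0: "0 \<le> D" using x C by (meson divide_nonneg_pos mult_nonneg_nonneg order_trans less_imp_le zero_le_power2 zero_less_numeral)
  define p where "p = sqrt (2 * D / C)"
  have p: "0 \<le> p" "p\<^sup>2 = 2 * D / C" using D0 C by (auto simp: p_def)
  define s where "s = sqrt \<gamma>"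
  have s: "0 \<le> s" "s\<^sup>2 = \<gamma>" "s < 1" using \<gamma> by (auto simp: s_def)
  have "C / 2 * p\<^sup>2 = D" using C by (simp add: p(2))
  then have "C / 2 * (norm x)\<^sup>2 \<le> C / 2 * p\<^sup>2" "C / 2 * (norm (d - x))\<^sup>2 \<le> C / 2 * (s * p)\<^sup>2"
    using x dx s(2) by (simp_all add: power_mult_distrib mult_ac)
  then have sq: "(norm x)\<^sup>2 \<le> p\<^sup>2" "(norm (d - x))\<^sup>2 \<le> (s * p)\<^sup>2"
    using C by (simp_all only: mult_le_cancel_left_pos half_gt_zero)
  have nx: "norm x \<le> p" using sq(1) p(1) by (rule power2_le_imp_le)
  have ndx: "norm (d - x) \<le> s * p" using sq(2) by (rule power2_le_imp_le) (use p s in simp)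
  have "norm d \<le> (1 + s) * p"
    using norm_triangle_ineq[of x "d - x"] nx ndx by (simp add: algebra_simps)
  \<comment> \<open>Since \<open>s\<^sup>2 = \<gamma>\<close>, multiplying by \<open>1 - s\<close>
    turns the factor \<open>1 + s\<close> into \<open>1 - \<gamma>\<close>, so that the bound also
    covers \<open>\<gamma> = 0\<close> uniformly.\<close>
  then have "(1 - s) * norm d \<le> (1 - s) * ((1 + s) * p)" using s by (intro mult_left_mono) auto
  also have "\<dots> = (1 - \<gamma>) * p" using s(2) by (simp add: algebra_simps power2_eq_square)
  finally have "((1 - s) * norm d)\<^sup>2 \<le> ((1 - \<gamma>) * p)\<^sup>2" using s by (intro power_mono) auto
  then have "(1 - s)\<^sup>2 * (norm d)\<^sup>2 \<le> (1 - \<gamma>)\<^sup>2 * (2 * D / C)" by (simp add: power_mult_distrib p(2))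
  then have "C / 2 * ((1 - s)\<^sup>2 * (norm d)\<^sup>2) \<le> C / 2 * ((1 - \<gamma>)\<^sup>2 * (2 * D / C))"
    using C by (intro mult_left_mono) auto
  then have bound: "(1 - sqrt \<gamma>)\<^sup>2 * C / 2 * (norm d)\<^sup>2 \<le> (1 - \<gamma>)\<^sup>2 * D"
    using C by (simp add: s_def mult_ac)
  show thesis
  proof (rule that[OF q' _ bound])
    show "q' \<le> q0 - (1 - \<gamma>) * D" using q'm by (simp add: D_def algebra_simps)
    show "ereal (q0 - D) \<le> Q e" for e
      using INF_lower[of e UNIV Q] xm(1) by (simp add: D_def)
  qed
qed

text \<open>The predicted change is the change of the model minus half the form of \<open>B\<close>
  at \<open>d\<close>, so \<open>C1\<close> contributes on top of the model decrease. The second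
  bound carries the factor \<open>1 - \<gamma>\<close> so that
  \<open>(1 - \<gamma>)\<^sup>2 * D\<close> can be traded for the strong convexity term in
  \<open>C2\<close>. The last bound tests the model on the segment towards \<open>b\<close>.\<close>

lemma subproblem_progress:
  fixes X :: "real^'m^'n" and blk :: "'m::finite \<Rightarrow> 'l::finite"
  assumes grad: "grad_G_conj g X a = p" and lower: "\<And>d. G a + p \<bullet> d \<le> G (a + d)"
    and \<psi>: "xi_conj blk \<xi> (- a) = ereal \<psi>"
    and sym: "transpose B = B" and ev: "\<And>k. eigenvalue B k \<Longrightarrow> C1 \<le> k" and C1: "0 \<le> C1"
    and C3: "spectral_norm B \<le> C3"
    and sc: "strongly_convex C2 (subproblem g blk \<xi> X a B)" and C2: "C2 > 0"
    and \<gamma>: "0 \<le> \<gamma>" "\<gamma> < 1"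
    and approx: "solves_approximately \<gamma> (subproblem g blk \<xi> X a B) d"
  obtains \<psi>' D where "xi_conj blk \<xi> (- a - d) = ereal \<psi>'"
    "p \<bullet> d + \<psi>' - \<psi> \<le> - (1 - \<gamma>) * D"
    "(1 - \<gamma>) * (p \<bullet> d + \<psi>' - \<psi>) \<le> - ((1 - \<gamma>) * C1 + (1 - sqrt \<gamma>)\<^sup>2 * C2) / 2 * (norm d)\<^sup>2"
    "\<And>b \<phi> u. \<lbrakk>xi_conj blk \<xi> (- b) = ereal \<phi>; 0 \<le> u; u \<le> 1\<rbrakk>
      \<Longrightarrow> u * (G a + \<psi> - (G b + \<phi>)) - u\<^sup>2 * C3 / 2 * (norm (a - b))\<^sup>2 \<le> D"
proof -
  let ?Q = "subproblem g blk \<xi> X a B"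
  have Q: "?Q e = ereal (p \<bullet> e + 1 / 2 * (e \<bullet> (B *v e))) + xi_conj blk \<xi> (- a - e)" for e
    by (simp add: subproblem_def grad)
  have form: "C1 * (norm e)\<^sup>2 \<le> e \<bullet> (B *v e)" for e
    by (rule eigenvalue_lower_bound_quadratic_form[OF sym ev])
  have form0: "0 \<le> e \<bullet> (B *v e)" for e
    using form[of e] C1 by (meson mult_nonneg_nonneg order_trans zero_le_power2)
  obtain c k where ck: "0 \<le> c" "\<And>u. ereal (- c * norm u - k) \<le> xi_conj blk \<xi> u"
    using xi_conj_norm_minorant by metis
  have minorant: "ereal (- (norm p + c) * norm e - (k + c * norm a)) \<le> ?Q e" for e
  proof -
    have "- (norm p * norm e) \<le> p \<bullet> e" using Cauchy_Schwarz_ineq2[of p e] by linarith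
    then have 1: "- (norm p * norm e) \<le> p \<bullet> e + 1 / 2 * (e \<bullet> (B *v e))" using form0[of e] by linarith
    have "norm (- a - e) \<le> norm a + norm e" using norm_triangle_ineq4[of "- a" e] by simp
    then have "c * norm (- a - e) \<le> c * (norm a + norm e)" using ck(1) by (rule mult_left_mono)
    then have 2: "ereal (- c * (norm a + norm e) - k) \<le> xi_conj blk \<xi> (- a - e)"
      by (intro order_trans[OF _ ck(2)]) simp
    have "ereal (- (norm p * norm e)) + ereal (- c * (norm a + norm e) - k) \<le> ?Q e"
      unfolding Q using 1 2 by (intro add_mono) auto
    moreover have "- (norm p * norm e) + (- c * (norm a + norm e) - k)
        = - (norm p + c) * norm e - (k + c * norm a)"
      by (simp add: algebra_simps)
    ultimately show ?thesis by (simp only: plus_ereal.simps)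
  qed
  have Q0: "?Q 0 = ereal \<psi>" by (simp add: Q \<psi>)
  have "0 \<le> norm p + c" using ck by simp
  from approximate_minimizer_bounds[OF sc C2 Q0 minorant this \<gamma> approx]
  obtain q' D where q': "?Q d = ereal q'" "q' \<le> \<psi> - (1 - \<gamma>) * D"
    "(1 - sqrt \<gamma>)\<^sup>2 * C2 / 2 * (norm d)\<^sup>2 \<le> (1 - \<gamma>)\<^sup>2 * D" "\<And>e. ereal (\<psi> - D) \<le> ?Q e"
    by blast
  obtain \<psi>' where \<psi>': "xi_conj blk \<xi> (- a - d) = ereal \<psi>'" "q' = p \<bullet> d + 1 / 2 * (d \<bullet> (B *v d)) + \<psi>'"
    using q'(1) unfolding Q by (cases "xi_conj blk \<xi> (- a - d)") auto
  show thesis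
  proof (rule that[OF \<psi>'(1)])
    have *: "p \<bullet> d + \<psi>' - \<psi> \<le> - (1 - \<gamma>) * D - 1 / 2 * (d \<bullet> (B *v d))"
      using q'(2) \<psi>'(2) by (simp add: algebra_simps)
    then show "p \<bullet> d + \<psi>' - \<psi> \<le> - (1 - \<gamma>) * D" using form0[of d] by linarith
    have "p \<bullet> d + \<psi>' - \<psi> \<le> - (1 - \<gamma>) * D - 1 / 2 * (C1 * (norm d)\<^sup>2)" using * form[of d] by linarith
    then have "(1 - \<gamma>) * (p \<bullet> d + \<psi>' - \<psi>) \<le> (1 - \<gamma>) * (- (1 - \<gamma>) * D - 1 / 2 * (C1 * (norm d)\<^sup>2))"
      using \<gamma> by (intro mult_left_mono) auto
    also have "\<dots> = - ((1 - \<gamma>)\<^sup>2 * D) - (1 - \<gamma>) * C1 / 2 * (norm d)\<^sup>2"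
      by (simp add: power2_eq_square algebra_simps)
    also have "\<dots> \<le> - ((1 - sqrt \<gamma>)\<^sup>2 * C2 / 2 * (norm d)\<^sup>2) - (1 - \<gamma>) * C1 / 2 * (norm d)\<^sup>2"
      using q'(3) by simp
    also have "\<dots> = - ((1 - \<gamma>) * C1 + (1 - sqrt \<gamma>)\<^sup>2 * C2) / 2 * (norm d)\<^sup>2"
      by (simp add: field_simps)
    finally show "(1 - \<gamma>) * (p \<bullet> d + \<psi>' - \<psi>)
      \<le> - ((1 - \<gamma>) * C1 + (1 - sqrt \<gamma>)\<^sup>2 * C2) / 2 * (norm d)\<^sup>2" .
  next
    fix b \<phi> and u :: real
    assume b: "xi_conj blk \<xi> (- b) = ereal \<phi>" and u: "0 \<le> u" "u \<le> 1"
    define e where "e = b - a"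
    \<comment> \<open>The test direction is \<open>u *\<^sub>R e\<close>: the conjugate is bounded
      by convexity, the quadratic term by \<open>C3\<close>, and the linear term by the first-order
      inequality for \<open>G\<close>.\<close>
    have "xi_conj blk \<xi> ((1 - u) *\<^sub>R (- a) + u *\<^sub>R (- b)) \<le> ereal ((1 - u) * \<psi> + u * \<phi>)"
      using u \<psi> b unfolding xi_conj_def by (intro conjugate_convex) auto
    moreover have "(1 - u) *\<^sub>R (- a) + u *\<^sub>R (- b) = - a - u *\<^sub>R e"
      by (simp add: e_def algebra_simps)
    ultimately have "?Q (u *\<^sub>R e) \<le> ereal (p \<bullet> (u *\<^sub>R e) + 1 / 2 * ((u *\<^sub>R e) \<bullet> (B *v (u *\<^sub>R e))))
        + ereal ((1 - u) * \<psi> + u * \<phi>)"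
      unfolding Q by (intro add_left_mono) simp
    with q'(4)[of "u *\<^sub>R e"] have "ereal (\<psi> - D)
        \<le> ereal (p \<bullet> (u *\<^sub>R e) + 1 / 2 * ((u *\<^sub>R e) \<bullet> (B *v (u *\<^sub>R e)))) + ereal ((1 - u) * \<psi> + u * \<phi>)"
      by (rule order_trans)
    then have 1: "\<psi> - D \<le> u * (p \<bullet> e) + u\<^sup>2 / 2 * (e \<bullet> (B *v e)) + (1 - u) * \<psi> + u * \<phi>"
      by (simp add: matrix_vector_mult_scaleR power2_eq_square)
    have "e \<bullet> (B *v e) \<le> C3 * (norm e)\<^sup>2"
      using quadratic_form_le_spectral_norm[of e B] C3 mult_right_mono[OF C3, of "(norm e)\<^sup>2"] by simp
    then have 2: "u\<^sup>2 / 2 * (e \<bullet> (B *v e)) \<le> u\<^sup>2 / 2 * (C3 * (norm e)\<^sup>2)" by (intro mult_left_mono) auto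
    have 3: "u * (p \<bullet> e) \<le> u * (G b - G a)"
      using lower[of e] u by (intro mult_left_mono) (auto simp: e_def)
    show "u * (G a + \<psi> - (G b + \<phi>)) - u\<^sup>2 * C3 / 2 * (norm (a - b))\<^sup>2 \<le> D"
      using 1 2 3 by (simp add: e_def norm_minus_commute algebra_simps)
  qed
qed

text \<open>Smoothness of \<open>G\<close> and convexity of the conjugate give a change of at most
  \<open>\<eta>\<close> times the predicted change plus a term quadratic in \<open>\<eta>\<close>;
  the condition \<open>small\<close> lets the fraction \<open>1 - \<tau>\<close> of the predicted
  decrease pay for that term.\<close>

lemma sufficient_decreaseI:
  fixes X :: "real^'m^'n" and blk :: "'m::finite \<Rightarrow> 'l::finite"
  assumes G: "\<And>a. G_conj g X a = ereal (G a)" and grad: "grad_G_conj g X a = p"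
    and upper: "\<And>d. G (a + d) \<le> G a + p \<bullet> d + (norm (X *v d))\<^sup>2 / (2 * \<sigma>)"
    and \<psi>: "xi_conj blk \<xi> (- a) = ereal \<psi>" "xi_conj blk \<xi> (- a - d) = ereal \<psi>'"
    and \<eta>: "0 \<le> \<eta>" "\<eta> \<le> 1"
    and small: "\<eta> * ((norm (X *v d))\<^sup>2 / (2 * \<sigma>)) \<le> (1 - \<tau>) * (- (p \<bullet> d + \<psi>' - \<psi>))"
  shows "sufficient_decrease g blk \<xi> X \<tau> a d \<eta>"
proof -
  have "xi_conj blk \<xi> ((1 - \<eta>) *\<^sub>R (- a) + \<eta> *\<^sub>R (- a - d)) \<le> ereal ((1 - \<eta>) * \<psi> + \<eta> * \<psi>')"
    using \<eta> \<psi> unfolding xi_conj_def by (intro conjugate_convex) auto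
  moreover have "(1 - \<eta>) *\<^sub>R (- a) + \<eta> *\<^sub>R (- a - d) = - (a + \<eta> *\<^sub>R d)" by (simp add: algebra_simps)
  ultimately have "dual g blk \<xi> X (a + \<eta> *\<^sub>R d) \<le> ereal (G (a + \<eta> *\<^sub>R d)) + ereal ((1 - \<eta>) * \<psi> + \<eta> * \<psi>')"
    unfolding dual_def G by (intro add_left_mono) simp
  also have "\<dots> \<le> ereal (G a + \<psi> + \<eta> * \<tau> * (p \<bullet> d + \<psi>' - \<psi>))"
  proof -
    have "G (a + \<eta> *\<^sub>R d) \<le> G a + \<eta> * (p \<bullet> d) + \<eta> * (\<eta> * ((norm (X *v d))\<^sup>2 / (2 * \<sigma>)))"
      using upper[of "\<eta> *\<^sub>R d"] by (simp add: matrix_vector_mult_scaleR power_mult_distrib power2_eq_square mult_ac)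
    moreover have "\<eta> * (\<eta> * ((norm (X *v d))\<^sup>2 / (2 * \<sigma>))) \<le> \<eta> * ((1 - \<tau>) * (- (p \<bullet> d + \<psi>' - \<psi>)))"
      using small \<eta>(1) by (rule mult_left_mono)
    ultimately show ?thesis by (simp add: algebra_simps)
  qed
  also have "\<dots> = dual g blk \<xi> X a + ereal (\<eta> * \<tau>) * predicted_change g blk \<xi> X a d"
    unfolding dual_def G predicted_change_def grad \<psi> by simp
  finally show ?thesis unfolding sufficient_decrease_def .
qed

text \<open>Either the first trial 1 is accepted, or the trial before the accepted one was rejected
  and hence exceeded \<open>L\<close>.\<close>

lemma backtracking_lower_bound:
  fixes \<beta> L :: real
  assumes \<beta>: "0 < \<beta>" "\<beta> < 1" and L: "L > 0"
    and P: "\<And>\<eta>. \<lbrakk>0 < \<eta>; \<eta> \<le> 1; \<eta> \<le> L\<rbrakk> \<Longrightarrow> P \<eta>"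
  defines "i \<equiv> LEAST i. P (\<beta> ^ i)"
  shows "P (\<beta> ^ i)" "min 1 (\<beta> * L) \<le> \<beta> ^ i"
proof -
  obtain n where "\<beta> ^ n < L" using real_arch_pow_inv[OF L \<beta>(2)] by blast
  then have "P (\<beta> ^ n)" using \<beta> by (intro P) (auto simp: power_le_one)
  then show "P (\<beta> ^ i)" unfolding i_def by (rule LeastI)
  show "min 1 (\<beta> * L) \<le> \<beta> ^ i"
  proof (cases i)
    case (Suc j)
    then have "\<not> P (\<beta> ^ j)" unfolding i_def by (metis lessI not_less_Least)
    then have "L < \<beta> ^ j" using P[of "\<beta> ^ j"] \<beta> by (force simp: power_le_one)
    then have "\<beta> * L \<le> \<beta> * \<beta> ^ j" using \<beta> by simp
    then show ?thesis using Suc by (simp add: min.coboundedI2)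
  qed simp
qed

lemma line_search_progress:
  fixes X :: "real^'m^'n" and blk :: "'m::finite \<Rightarrow> 'l::finite"
  assumes G: "\<And>a. G_conj g X a = ereal (G a)" and grad: "grad_G_conj g X a = p"
    and upper: "\<And>d. G (a + d) \<le> G a + p \<bullet> d + (norm (X *v d))\<^sup>2 / (2 * \<sigma>)"
    and \<psi>: "xi_conj blk \<xi> (- a) = ereal \<psi>" "xi_conj blk \<xi> (- a - d) = ereal \<psi>'"
    and \<sigma>: "\<sigma> > 0" and \<beta>: "0 < \<beta>" "\<beta> < 1" and \<tau>: "0 < \<tau>" "\<tau> < 1" and \<gamma>: "\<gamma> < 1"
    and K: "K > 0" "(1 - \<gamma>) * (p \<bullet> d + \<psi>' - \<psi>) \<le> - K / 2 * (norm d)\<^sup>2"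
    and step: "backtracking_step g blk \<xi> X \<beta> \<tau> a d \<eta> \<or> exact_step g blk \<xi> X a d \<eta>"
  defines "m \<equiv> (if X = 0 then 1 - \<gamma>
      else min (1 - \<gamma>) (\<beta> * (1 - \<tau>) * \<sigma> * K / spectral_norm (transpose X ** X)))"
  obtains \<phi> where "xi_conj blk \<xi> (- (a + \<eta> *\<^sub>R d)) = ereal \<phi>"
    "(1 - \<gamma>) * (G (a + \<eta> *\<^sub>R d) + \<phi> - (G a + \<psi>)) \<le> m * \<tau> * (p \<bullet> d + \<psi>' - \<psi>)"
proof -
  let ?S = "spectral_norm (transpose X ** X)"
  define \<Delta> where "\<Delta> = p \<bullet> d + \<psi>' - \<psi>"
  have \<Delta>: "(1 - \<gamma>) * \<Delta> \<le> - K / 2 * (norm d)\<^sup>2" using K(2) by (simp add: \<Delta>_def)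
  moreover have "- K / 2 * (norm d)\<^sup>2 \<le> 0" using K(1) by simp
  ultimately have "(1 - \<gamma>) * \<Delta> \<le> 0" by linarith
  then have \<Delta>0: "\<Delta> \<le> 0" using \<gamma> by (simp add: mult_le_0_iff)
  have S: "?S > 0" if "X \<noteq> 0" using spectral_norm_gram_pos[OF that] .
  \<comment> \<open>Solves \<open>small\<close> for the step size after bounding
    \<open>norm (X *v d)\<close> by the spectral norm and \<open>norm d\<close> by the predicted
    change. For \<open>X = 0\<close> every step in the unit interval is accepted, and
    \<open>1 / \<beta>\<close> makes \<open>\<beta> * L\<close> equal to 1.\<close>
  define L where "L = (if X = 0 then 1 / \<beta> else (1 - \<tau>) * \<sigma> * K / ((1 - \<gamma>) * ?S))"
  have L: "L > 0" using \<beta> \<tau> \<sigma> K(1) \<gamma> S by (auto simp: L_def)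
  have "m = (1 - \<gamma>) * min 1 (\<beta> * L)"
    using \<gamma> \<beta> S by (auto simp: m_def L_def min_mult_distrib_left)
  have decrease: "sufficient_decrease g blk \<xi> X \<tau> a d h" if h: "0 < h" "h \<le> 1" "h \<le> L" for h
  proof (rule sufficient_decreaseI[OF G grad upper \<psi>])
    show "h * ((norm (X *v d))\<^sup>2 / (2 * \<sigma>)) \<le> (1 - \<tau>) * (- (p \<bullet> d + \<psi>' - \<psi>))"
    proof (cases "X = 0")
      case True
      have "0 \<le> (1 - \<tau>) * (- \<Delta>)" using \<Delta>0 \<tau> by (intro mult_nonneg_nonneg) auto
      with True show ?thesis by (simp add: \<Delta>_def)
    next
      case False
      have "h * ((norm (X *v d))\<^sup>2 / (2 * \<sigma>)) \<le> L * (?S * (norm d)\<^sup>2 / (2 * \<sigma>))"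
        using h L \<sigma> by (intro mult_mono divide_right_mono norm_matrix_vector_squared_le) auto
      also have "\<dots> = (1 - \<tau>) * (K / 2 * (norm d)\<^sup>2 / (1 - \<gamma>))"
        using False S \<sigma> \<gamma> by (simp add: L_def)
      also have "\<dots> \<le> (1 - \<tau>) * (- \<Delta>)"
      proof (rule mult_left_mono)
        have "K / 2 * (norm d)\<^sup>2 \<le> - \<Delta> * (1 - \<gamma>)" using \<Delta> by (simp add: mult.commute)
        then show "K / 2 * (norm d)\<^sup>2 / (1 - \<gamma>) \<le> - \<Delta>" using \<gamma> by (simp only: pos_divide_le_eq diff_gt_0_iff_gt)
      qed (use \<tau> in simp)
      finally show ?thesis by (simp add: \<Delta>_def)
    qed
  qed (use h in auto)
  define i where "i = (LEAST i. sufficient_decrease g blk \<xi> X \<tau> a d (\<beta> ^ i))"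
  have i: "sufficient_decrease g blk \<xi> X \<tau> a d (\<beta> ^ i)" "min 1 (\<beta> * L) \<le> \<beta> ^ i"
    unfolding i_def using backtracking_lower_bound[OF \<beta> L, of "sufficient_decrease g blk \<xi> X \<tau> a d"] decrease
    by blast+
  \<comment> \<open>Both variants do at least as well as the backtracking step: exact line search
    minimizes over all steps, including \<open>\<beta> ^ i\<close>.\<close>
  have "dual g blk \<xi> X (a + \<eta> *\<^sub>R d) \<le> dual g blk \<xi> X (a + \<beta> ^ i *\<^sub>R d)"
    using step unfolding backtracking_step_def exact_step_def is_arg_min_def i_def
    by (auto simp: not_less)
  also have "\<dots> \<le> dual g blk \<xi> X a + ereal (\<beta> ^ i * \<tau>) * predicted_change g blk \<xi> X a d"
    using i(1) unfolding sufficient_decrease_def .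
  also have "\<dots> = ereal (G a + \<psi> + \<beta> ^ i * \<tau> * \<Delta>)"
    unfolding dual_def G predicted_change_def grad \<psi> by (simp add: \<Delta>_def)
  finally have le: "ereal (G (a + \<eta> *\<^sub>R d)) + xi_conj blk \<xi> (- (a + \<eta> *\<^sub>R d))
      \<le> ereal (G a + \<psi> + \<beta> ^ i * \<tau> * \<Delta>)"
    by (simp add: dual_def G)
  \<comment> \<open>A finite upper bound on the new dual value also shows that the new iterate is
    feasible.\<close>
  then obtain \<phi> where \<phi>: "xi_conj blk \<xi> (- (a + \<eta> *\<^sub>R d)) = ereal \<phi>"
    using xi_conj_not_MInfty[of blk \<xi> "- (a + \<eta> *\<^sub>R d)"]
    by (cases "xi_conj blk \<xi> (- (a + \<eta> *\<^sub>R d))") auto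
  have "G (a + \<eta> *\<^sub>R d) + \<phi> - (G a + \<psi>) \<le> \<beta> ^ i * (\<tau> * \<Delta>)" using le \<phi> by (simp add: mult.assoc)
  also have "\<dots> \<le> min 1 (\<beta> * L) * (\<tau> * \<Delta>)"
    using i(2) \<Delta>0 \<tau> by (intro mult_right_mono_neg) (auto simp: mult_le_0_iff)
  finally have "(1 - \<gamma>) * (G (a + \<eta> *\<^sub>R d) + \<phi> - (G a + \<psi>)) \<le> (1 - \<gamma>) * (min 1 (\<beta> * L) * (\<tau> * \<Delta>))"
    using \<gamma> by (intro mult_left_mono) auto
  also have "\<dots> = m * \<tau> * \<Delta>" using \<open>m = _\<close> by simp
  finally show thesis using that[OF \<phi>] by (simp add: \<Delta>_def)
qed

text \<open>The growth condition keeps the infimum of squared distances finite, so solutions exist;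
  one within \<open>2 * e / \<mu>\<close> of the infimum loses only \<open>e\<close> after scaling
  by \<open>\<mu> / 2\<close>.\<close>

lemma quadratic_growth_near_solution:
  assumes qg: "quadratic_growth g blk \<xi> X \<mu>" and \<mu>: "\<mu> > 0"
    and a: "dual g blk \<xi> X a = ereal fa" and opt: "dual_opt g blk \<xi> X = ereal fs" and e: "e > 0"
  obtains b where "dual g blk \<xi> X b = ereal fs" "\<mu> / 2 * (norm (a - b))\<^sup>2 \<le> fa - fs + e"
proof -
  let ?I = "INF b \<in> dual_solutions g blk \<xi> X. ereal ((norm (a - b))\<^sup>2)"
  have le: "ereal (\<mu> / 2) * ?I \<le> ereal (fa - fs)"
    using qg[unfolded quadratic_growth_def, rule_format, of a] a opt by simp
  have "0 \<le> ?I" by (intro INF_greatest) simp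
  moreover have "?I \<noteq> \<infinity>"
  proof
    assume "?I = \<infinity>"
    with le \<mu> show False by simp
  qed
  ultimately obtain r where r: "?I = ereal r" by (cases ?I) auto
  have "?I < ereal (r + 2 * e / \<mu>)" unfolding r using e \<mu> by simp
  then obtain b where b: "b \<in> dual_solutions g blk \<xi> X" "(norm (a - b))\<^sup>2 < r + 2 * e / \<mu>"
    by (auto simp: INF_less_iff)
  have "\<mu> / 2 * (norm (a - b))\<^sup>2 \<le> \<mu> / 2 * (r + 2 * e / \<mu>)" using b(2) \<mu> by (intro mult_left_mono) auto
  also have "\<dots> = \<mu> / 2 * r + e" using \<mu> by (simp add: field_simps)
  also have "\<dots> \<le> fa - fs + e" using le r by simp
  finally show thesis using that b(1) opt by (auto simp: dual_solutions_def)
qed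

theorem theorem2:
  fixes g :: "real^'n \<Rightarrow> ereal"
    and blk :: "'m::finite \<Rightarrow> 'l::finite"
    and \<xi> :: "'l \<Rightarrow> real^'m \<Rightarrow> real"
    and X :: "real^'m^'n"
    and B :: "nat \<Rightarrow> real^'m^'m"
    and \<alpha> \<Delta>\<alpha> :: "nat \<Rightarrow> real^'m"
    and \<eta> :: "nat \<Rightarrow> real"
    and \<sigma> \<beta> \<tau> \<mu> \<gamma> C1 C2 C3 :: real
  assumes blocks: "surj blk"
    and g_strongly_convex: "\<sigma> > 0" "strongly_convex \<sigma> g"
    and xi_convex: "\<And>i. convex_on (block_space blk i) (\<xi> i)"
    and primal_proper: "proper_fun (primal g blk \<xi> X)"
    and primal_closed: "closed (ereal_epigraph (primal g blk \<xi> X))"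
    and primal_convex: "convex (ereal_epigraph (primal g blk \<xi> X))"
    and primal_solution: "\<exists>w. \<forall>v. primal g blk \<xi> X w \<le> primal g blk \<xi> X v"
    and xi_regular:
      "(\<exists>\<rho>>0. (\<forall>z. block_sum blk \<xi> differentiable (at z)) \<and>
           lipschitz_on \<rho> UNIV (gradient (block_sum blk \<xi>)))
        \<or> (\<exists>L>0. lipschitz_on L UNIV (block_sum blk \<xi>))"
    and start: "\<alpha> 0 \<in> dual_feasible blk \<xi>"
    and B_symmetric: "\<And>t. transpose (B t) = B t"
    and update: "\<And>t. \<alpha> (Suc t) = \<alpha> t + \<eta> t *\<^sub>R \<Delta>\<alpha> t"
    and line_search_params: "0 < \<beta>" "\<beta> < 1" "0 < \<tau>" "\<tau> < 1"
    and line_search: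
      "(\<forall>t. backtracking_step g blk \<xi> X \<beta> \<tau> (\<alpha> t) (\<Delta>\<alpha> t) (\<eta> t))
        \<or> (\<forall>t. exact_step g blk \<xi> X (\<alpha> t) (\<Delta>\<alpha> t) (\<eta> t))"
    and growth: "\<mu> > 0" "quadratic_growth g blk \<xi> X \<mu>"
    and B_bounded: "C3 > 0" "\<And>t. spectral_norm (B t) \<le> C3"
    and constants: "0 \<le> C1" "C1 \<le> C3" "C2 > 0" "0 \<le> \<gamma>" "\<gamma> < 1"
      "(1 + sqrt \<gamma>) * C1 + (1 - sqrt \<gamma>) * C2 > 0"
    and B_eigenvalues: "\<And>t k. eigenvalue (B t) k \<Longrightarrow> C1 \<le> k"
    and Q_strongly_convex: "\<And>t. strongly_convex C2 (subproblem g blk \<xi> X (\<alpha> t) (B t))"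
    and subproblem_solved: "\<And>t. solves_approximately \<gamma> (subproblem g blk \<xi> X (\<alpha> t) (B t)) (\<Delta>\<alpha> t)"
  shows
    "let m = (if X = 0 then 1 - \<gamma>
              else min (1 - \<gamma>)
                (\<beta> * (1 - \<tau>) * \<sigma> * ((1 - \<gamma>) * C1 + (1 - sqrt \<gamma>)\<^sup>2 * C2)
                   / spectral_norm (transpose X ** X)));
         q = (if \<mu> \<le> 2 * C3 then 1 - \<tau> * \<mu> / (4 * C3) * m
              else 1 - \<tau> * (1 - C3 / \<mu>) * m)
     in 0 \<le> q \<and> q < 1 \<and>
        (\<lambda>t. dual g blk \<xi> X (\<alpha> t)) \<longlonglongrightarrow> dual_opt g blk \<xi> X \<and>
        (\<forall>t. dual g blk \<xi> X (\<alpha> (Suc t)) - dual_opt g blk \<xi> X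
              \<le> ereal q * (dual g blk \<xi> X (\<alpha> t) - dual_opt g blk \<xi> X))"
proof -
  let ?f = "dual g blk \<xi> X"

  \<comment> \<open>The constants of the rate\<close>
  define S where "S = spectral_norm (transpose X ** X)"
  define K where "K = (1 - \<gamma>) * C1 + (1 - sqrt \<gamma>)\<^sup>2 * C2"
  define m where "m = (if X = 0 then 1 - \<gamma> else min (1 - \<gamma>) (\<beta> * (1 - \<tau>) * \<sigma> * K / S))"
  \<comment> \<open>The maximizer of \<open>u - u\<^sup>2 * C3 / \<mu>\<close> over the unit
    interval: the vertex of the parabola, capped at 1. The maximum is
    \<open>\<mu> / (4 * C3)\<close> or \<open>1 - C3 / \<mu>\<close>.\<close>
  define u where "u = (if \<mu> \<le> 2 * C3 then \<mu> / (2 * C3) else 1)"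
  define q where "q = 1 - \<tau> * m * (u - u\<^sup>2 * C3 / \<mu>)"
  have q_eq: "(if \<mu> \<le> 2 * C3 then 1 - \<tau> * \<mu> / (4 * C3) * m else 1 - \<tau> * (1 - C3 / \<mu>) * m) = q"
    using growth(1) B_bounded(1) by (auto simp: q_def u_def field_simps power2_eq_square)
  have u: "0 \<le> u" "u \<le> 1" using growth(1) B_bounded(1) by (auto simp: u_def)
  have coeff: "0 < u - u\<^sup>2 * C3 / \<mu>" "u - u\<^sup>2 * C3 / \<mu> \<le> 1"
  proof -
    have "u - u\<^sup>2 * C3 / \<mu> = (if \<mu> \<le> 2 * C3 then \<mu> / (4 * C3) else 1 - C3 / \<mu>)"
      using growth(1) B_bounded(1) by (auto simp: u_def field_simps power2_eq_square)
    then show "0 < u - u\<^sup>2 * C3 / \<mu>" "u - u\<^sup>2 * C3 / \<mu> \<le> 1"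
      using growth(1) B_bounded(1) by auto
  qed
  have K: "K > 0"
  proof -
    have "sqrt \<gamma> < 1" using constants by simp
    \<comment> \<open>Factoring \<open>1 - \<gamma>\<close> as a difference of squares exposes the
      combination of \<open>C1\<close> and \<open>C2\<close> that is assumed positive.\<close>
    moreover have "K = (1 - sqrt \<gamma>) * ((1 + sqrt \<gamma>) * C1 + (1 - sqrt \<gamma>) * C2)"
      using constants(4) by (simp add: K_def algebra_simps power2_eq_square flip: real_sqrt_mult)
    ultimately show ?thesis using constants(6) by simp
  qed
  have m: "0 < m" "m \<le> 1"
    using K constants(4,5) line_search_params g_strongly_convex(1) spectral_norm_gram_pos[of X]
    by (auto simp: m_def S_def min_le_iff_disj)
  have mc: "0 < m * (u - u\<^sup>2 * C3 / \<mu>)" "m * (u - u\<^sup>2 * C3 / \<mu>) \<le> 1"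
    using m coeff by (auto intro: mult_le_one)
  have q: "0 \<le> q" "q < 1"
  proof -
    have "\<tau> * (m * (u - u\<^sup>2 * C3 / \<mu>)) \<le> 1"
      by (rule mult_le_one[OF less_imp_le[OF line_search_params(4)] less_imp_le[OF mc(1)] mc(2)])
    moreover have "0 < \<tau> * (m * (u - u\<^sup>2 * C3 / \<mu>))" using mc(1) line_search_params(3) by (rule mult_pos_pos[rotated])
    ultimately show "0 \<le> q" "q < 1" by (auto simp: q_def mult.assoc)
  qed

  \<comment> \<open>Smoothness of the conjugate term in the dual objective\<close>
  have "continuous_on UNIV (block_sum blk \<xi>)"
    using xi_regular differentiable_imp_continuous_on lipschitz_on_continuous_on
    unfolding differentiable_on_def by blast
  then have g: "proper_fun g" "closed (ereal_epigraph g)"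
    using proper_fun_primalD[OF primal_proper] closed_epigraph_primalD[OF primal_closed] by auto
  from conjugate_strongly_convex_bounds[OF g_strongly_convex(2,1) g]
  obtain H w where H: "\<And>u. conjugate g u = ereal (H u)"
    "\<And>u v. H u + w u \<bullet> v \<le> H (u + v)"
    "\<And>u v. H (u + v) \<le> H u + w u \<bullet> v + (norm v)\<^sup>2 / (2 * \<sigma>)" by blast
  define G where "G = (\<lambda>a. H (X *v a))"
  \<comment> \<open>The chain rule for the conjugate of \<open>g\<close> composed with
    \<open>X\<close>.\<close>
  define p where "p = (\<lambda>a. transpose X *v w (X *v a))"
  have p: "p a \<bullet> d = w (X *v a) \<bullet> (X *v d)" for a d
    unfolding p_def by (rule inner_transpose_matrix)
  have G: "G_conj g X a = ereal (G a)" for a by (simp add: G_conj_def G_def H(1))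
  have lower: "G a + p a \<bullet> d \<le> G (a + d)" for a d
    using H(2)[of "X *v a" "X *v d"] by (simp add: G_def p matrix_vector_right_distrib)
  have upper: "G (a + d) \<le> G a + p a \<bullet> d + (norm (X *v d))\<^sup>2 / (2 * \<sigma>)" for a d
    using H(3)[of "X *v a" "X *v d"] by (simp add: G_def p matrix_vector_right_distrib)
  have grad: "grad_G_conj g X a = p a" for a
  proof -
    have "gradient G a = p a"
    proof (rule gradient_quadratic_bounds)
      fix d
      have "(norm (X *v d))\<^sup>2 / (2 * \<sigma>) \<le> S * (norm d)\<^sup>2 / (2 * \<sigma>)"
        using g_strongly_convex(1) norm_matrix_vector_squared_le[of X d]
        by (intro divide_right_mono) (auto simp: S_def)
      then show "G (a + d) \<le> G a + p a \<bullet> d + S / (2 * \<sigma>) * (norm d)\<^sup>2" using upper[of a d] by simp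
    qed (rule lower)
    then show ?thesis by (simp add: grad_G_conj_def G)
  qed

  \<comment> \<open>Finiteness of the dual optimal value\<close>
  have opt_le: "dual_opt g blk \<xi> X \<le> ?f a" if "xi_conj blk \<xi> (- a) = ereal \<psi>" for a \<psi>
    unfolding dual_opt_def using that by (intro INF_lower) (simp add: dual_feasible_iff)
  obtain fs where fs: "dual_opt g blk \<xi> X = ereal fs"
  proof -
    obtain w0 where "w0 \<in> edom (primal g blk \<xi> X)" "primal g blk \<xi> X w0 \<noteq> -\<infinity>"
      using primal_proper unfolding proper_fun_def by auto
    then obtain c where c: "primal g blk \<xi> X w0 = ereal c"
      by (cases "primal g blk \<xi> X w0") (auto simp: edom_def)
    \<comment> \<open>Weak duality at a point of the primal domain bounds the optimum below; the
      feasible start bounds it above.\<close>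
    have "ereal (- c) \<le> dual_opt g blk \<xi> X"
      unfolding dual_opt_def using g(1)
      by (intro INF_greatest weak_duality[of _ _ _ _ w0]) (auto simp: c proper_fun_def)
    moreover have "dual_opt g blk \<xi> X < \<infinity>"
    proof -
      obtain \<psi> where \<psi>: "xi_conj blk \<xi> (- \<alpha> 0) = ereal \<psi>"
        using start xi_conj_not_MInfty[of blk \<xi> "- \<alpha> 0"] unfolding dual_feasible_iff
        by (cases "xi_conj blk \<xi> (- \<alpha> 0)") auto
      have "dual_opt g blk \<xi> X \<le> ereal (G (\<alpha> 0) + \<psi>)"
        using opt_le[OF \<psi>] by (simp add: dual_def G \<psi>)
      then show ?thesis using le_less_trans by fastforce
    qed
    ultimately show thesis using that by (cases "dual_opt g blk \<xi> X") auto
  qed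

  \<comment> \<open>Contraction of the dual gap in one step\<close>
  have step: "\<exists>\<phi>. xi_conj blk \<xi> (- \<alpha> (Suc t)) = ereal \<phi> \<and>
      G (\<alpha> (Suc t)) + \<phi> - fs \<le> q * (G (\<alpha> t) + \<psi> - fs)"
    if \<psi>: "xi_conj blk \<xi> (- \<alpha> t) = ereal \<psi>" for t \<psi>
  proof -
    let ?a = "\<alpha> t" and ?d = "\<Delta>\<alpha> t"
    define \<delta> where "\<delta> = G ?a + \<psi> - fs"
    obtain \<psi>' D where \<psi>': "xi_conj blk \<xi> (- ?a - ?d) = ereal \<psi>'"
      and \<Delta>_le: "p ?a \<bullet> ?d + \<psi>' - \<psi> \<le> - (1 - \<gamma>) * D"
      and \<Delta>_norm: "(1 - \<gamma>) * (p ?a \<bullet> ?d + \<psi>' - \<psi>) \<le> - K / 2 * (norm ?d)\<^sup>2"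
      and D: "\<And>b \<phi>. xi_conj blk \<xi> (- b) = ereal \<phi>
        \<Longrightarrow> u * (G ?a + \<psi> - (G b + \<phi>)) - u\<^sup>2 * C3 / 2 * (norm (?a - b))\<^sup>2 \<le> D"
      using subproblem_progress[OF grad lower \<psi> B_symmetric B_eigenvalues[of t] constants(1) B_bounded(2)
          Q_strongly_convex constants(3-5) subproblem_solved, folded K_def] u by metis
    obtain \<phi> where \<phi>: "xi_conj blk \<xi> (- (?a + \<eta> t *\<^sub>R ?d)) = ereal \<phi>"
      "(1 - \<gamma>) * (G (?a + \<eta> t *\<^sub>R ?d) + \<phi> - (G ?a + \<psi>)) \<le> m * \<tau> * (p ?a \<bullet> ?d + \<psi>' - \<psi>)"
      using line_search_progress[OF G grad upper \<psi> \<psi>' g_strongly_convex(1) line_search_params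
          constants(5) K \<Delta>_norm, of "\<eta> t"] line_search unfolding m_def S_def by blast
    have "m * \<tau> * (p ?a \<bullet> ?d + \<psi>' - \<psi>) \<le> m * \<tau> * (- (1 - \<gamma>) * D)"
      using \<Delta>_le m line_search_params by (intro mult_left_mono) auto
    with \<phi>(2) have "(1 - \<gamma>) * (G (?a + \<eta> t *\<^sub>R ?d) + \<phi> - (G ?a + \<psi>)) \<le> (1 - \<gamma>) * (- (m * \<tau> * D))"
      by (simp add: algebra_simps)
    then have dec: "G (?a + \<eta> t *\<^sub>R ?d) + \<phi> - (G ?a + \<psi>) \<le> - (m * \<tau> * D)"
      using constants(5) by (simp only: mult_le_cancel_left_pos diff_gt_0_iff_gt)
    have "(u - u\<^sup>2 * C3 / \<mu>) * \<delta> \<le> D"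
    proof (rule field_le_epsilon)
      fix e :: real assume e: "0 < e"
      \<comment> \<open>Scaled so that the slack in the choice of \<open>b\<close> enters as
        \<open>u\<^sup>2 * e\<close>, which is at most \<open>e\<close>.\<close>
      define e' where "e' = e * \<mu> / C3"
      have e': "e' > 0" using e growth(1) B_bounded(1) by (simp add: e'_def)
      have "?f ?a = ereal (G ?a + \<psi>)" by (simp add: dual_def G \<psi>)
      from quadratic_growth_near_solution[OF growth(2,1) this fs e']
      obtain b where b: "?f b = ereal fs" "\<mu> / 2 * (norm (?a - b))\<^sup>2 \<le> \<delta> + e'"
        unfolding \<delta>_def by blast
      have xb: "xi_conj blk \<xi> (- b) = ereal (fs - G b)"
        using b(1) unfolding dual_def G by (cases "xi_conj blk \<xi> (- b)") auto
      have "u * \<delta> - u\<^sup>2 * C3 / 2 * (norm (?a - b))\<^sup>2 \<le> D" using D[OF xb] by (simp add: \<delta>_def)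
      moreover have "u\<^sup>2 * C3 / 2 * (norm (?a - b))\<^sup>2 \<le> u\<^sup>2 * C3 / \<mu> * \<delta> + u\<^sup>2 * C3 / \<mu> * e'"
      proof -
        have "u\<^sup>2 * C3 / \<mu> * (\<mu> / 2 * (norm (?a - b))\<^sup>2) \<le> u\<^sup>2 * C3 / \<mu> * (\<delta> + e')"
          using b(2) growth(1) B_bounded(1) by (intro mult_left_mono) auto
        then show ?thesis using growth(1) by (simp add: distrib_left)
      qed
      moreover have "u\<^sup>2 * C3 / \<mu> * e' \<le> e"
      proof -
        have "u\<^sup>2 * C3 / \<mu> * e' = u\<^sup>2 * e" using growth(1) B_bounded(1) by (simp add: e'_def)
        also have "\<dots> \<le> 1 * e" using u e by (intro mult_right_mono) (auto simp: power_le_one)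
        finally show ?thesis by simp
      qed
      ultimately show "(u - u\<^sup>2 * C3 / \<mu>) * \<delta> \<le> D + e"
        unfolding left_diff_distrib by linarith
    qed
    then have "m * \<tau> * ((u - u\<^sup>2 * C3 / \<mu>) * \<delta>) \<le> m * \<tau> * D"
      using m line_search_params by (intro mult_left_mono) auto
    with dec have "G (?a + \<eta> t *\<^sub>R ?d) + \<phi> - fs \<le> q * \<delta>"
      by (simp add: q_def \<delta>_def algebra_simps)
    with \<phi>(1) show ?thesis by (auto simp: update \<delta>_def)
  qed

  \<comment> \<open>Feasibility of all iterates and convergence of the dual values\<close>
  have "\<exists>\<psi>. xi_conj blk \<xi> (- \<alpha> t) = ereal \<psi>" for t
  proof (induction t)
    case 0
    then show ?case using start xi_conj_not_MInfty[of blk \<xi> "- \<alpha> 0"] unfolding dual_feasible_iff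
      by (cases "xi_conj blk \<xi> (- \<alpha> 0)") auto
  next
    case (Suc t)
    then show ?case using step by blast
  qed
  then obtain \<psi> where \<psi>: "\<And>t. xi_conj blk \<xi> (- \<alpha> t) = ereal (\<psi> t)" by metis
  define F where "F = (\<lambda>t. G (\<alpha> t) + \<psi> t)"
  have F: "?f (\<alpha> t) = ereal (F t)" for t by (simp add: dual_def G \<psi> F_def)
  have F_ge: "fs \<le> F t" for t using opt_le[OF \<psi>[of t]] by (simp add: F fs)
  have F_Suc: "F (Suc t) - fs \<le> q * (F t - fs)" for t
    using step[OF \<psi>[of t]] \<psi>[of "Suc t"] by (simp add: F_def)
  have F_pow: "F t - fs \<le> q ^ t * (F 0 - fs)" for t
  proof (induction t)
    case (Suc t)
    have "q * (F t - fs) \<le> q * (q ^ t * (F 0 - fs))" using Suc q(1) by (rule mult_left_mono)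
    then show ?case using F_Suc[of t] by (simp add: mult.assoc)
  qed simp
  have "(\<lambda>t. F t - fs) \<longlonglongrightarrow> 0"
  proof (rule tendsto_sandwich)
    show "(\<lambda>t. 0) \<longlonglongrightarrow> (0::real)" by simp
    have "(\<lambda>t. q ^ t * (F 0 - fs)) \<longlonglongrightarrow> 0 * (F 0 - fs)"
      using q by (intro tendsto_intros LIMSEQ_realpow_zero)
    then show "(\<lambda>t. q ^ t * (F 0 - fs)) \<longlonglongrightarrow> 0" by simp
  qed (use F_ge F_pow in auto)
  then have "F \<longlonglongrightarrow> fs" by (simp add: LIM_zero_iff)
  then have "(\<lambda>t. ?f (\<alpha> t)) \<longlonglongrightarrow> dual_opt g blk \<xi> X" by (simp add: F fs)
  moreover have "?f (\<alpha> (Suc t)) - dual_opt g blk \<xi> X \<le> ereal q * (?f (\<alpha> t) - dual_opt g blk \<xi> X)" for t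
    using F_Suc[of t] by (simp add: F fs)
  ultimately show ?thesis
    unfolding Let_def S_def[symmetric] K_def[symmetric] m_def[symmetric] q_eq using q by blast
qed

end
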